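(* Let $N\ge3$ be an integer and $\frac{2}{N-2}<\alpha<\frac4{N-2}$. There exists a two-parameter family of radially symmetric, sign-changing, stationary solutions $U\in C^2(\mathbb{R}^N\setminus\{0\})\cap L^{\alpha+1}_{\mathrm{loc}}(\mathbb{R}^N)$ of $\partial_tu=\Delta u+|u|^\alpha u$ in the sense of distributions (that is, $-\Delta U=|U|^\alpha U$ in $\mathcal{D}'(\mathbb{R}^N)$), which are singular at $x=0$. Each of these solutions satisfies $|U(x)|\le C|x|^{-(N-2-\frac2\alpha)}$ for $|x|>1$ (with some constant $C$) and oscillates indefinitely as $|x|\to\infty$.
   Context: All functions are real-valued. "Two-parameter family" means a family indexed by the points of a nonempty open subset of $\mathbb{R}^2$, with different parameters giving different solutions. "Singular at $x=0$" means that $U(x)$ has no finite limit as $x\to0$. "Oscillates indefinitely as $|x|\to\infty$" means that, writing $U(x)=u(|x|)$, $u$ changes sign on $(R,\infty)$ for every $R>0$. *)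

theory Defs
  imports "HOL-Analysis.Analysis"
begin

(* C^k on an open set S: the Frechet derivative exists at every point of S, and every
   directional derivative is again C^(k-1) on S. *)
fun Ck_on :: "nat \<Rightarrow> ('a::euclidean_space \<Rightarrow> real) \<Rightarrow> 'a set \<Rightarrow> bool" where
  "Ck_on 0 f S \<longleftrightarrow> continuous_on S f"
| "Ck_on (Suc k) f S \<longleftrightarrow>
     (\<forall>x\<in>S. f differentiable (at x)) \<and> (\<forall>v. Ck_on k (\<lambda>x. frechet_derivative f (at x) v) S)"

definition laplacian :: "('a::euclidean_space \<Rightarrow> real) \<Rightarrow> 'a \<Rightarrow> real" where
  "laplacian f x =
     (\<Sum>b\<in>Basis. frechet_derivative (\<lambda>y. frechet_derivative f (at y) b) (at x) b)"

definition test_function :: "('a::euclidean_space \<Rightarrow> real) \<Rightarrow> bool" where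
  "test_function \<phi> \<longleftrightarrow> (\<forall>k. Ck_on k \<phi> UNIV) \<and> compact (closure {x. \<phi> x \<noteq> 0})"

(* L^p_loc on the whole space. Measurability is required separately: it does not follow from
   measurability of the absolute value. *)
definition Lp_loc :: "real \<Rightarrow> ('a::euclidean_space \<Rightarrow> real) \<Rightarrow> bool" where
  "Lp_loc p f \<longleftrightarrow> f \<in> borel_measurable lebesgue \<and>
     (\<forall>K. compact K \<longrightarrow> set_integrable lebesgue K (\<lambda>x. \<bar>f x\<bar> powr p))"

(* - Laplacian U = f in the sense of distributions. Both functions have to be locally
   integrable, so that they are distributions and the integrals below are genuine. *)
definition distributional_neg_laplacian_eq ::
    "('a::euclidean_space \<Rightarrow> real) \<Rightarrow> ('a \<Rightarrow> real) \<Rightarrow> bool" where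
  "distributional_neg_laplacian_eq U f \<longleftrightarrow> Lp_loc 1 U \<and> Lp_loc 1 f \<and>
     (\<forall>\<phi>. test_function \<phi> \<longrightarrow>
        - (LINT x|lebesgue. U x * laplacian \<phi> x) = (LINT x|lebesgue. f x * \<phi> x))"

definition stationary_solution :: "real \<Rightarrow> ('a::euclidean_space \<Rightarrow> real) \<Rightarrow> bool" where
  "stationary_solution \<alpha> U \<longleftrightarrow>
     distributional_neg_laplacian_eq U (\<lambda>x. \<bar>U x\<bar> powr \<alpha> * U x)"

definition changes_sign_on :: "('a \<Rightarrow> real) \<Rightarrow> 'a set \<Rightarrow> bool" where
  "changes_sign_on f S \<longleftrightarrow> (\<exists>x\<in>S. f x > 0) \<and> (\<exists>y\<in>S. f y < 0)"

end

theory Submission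
  imports Defs
begin

text \<open>
  Write \<open>p = 2 / \<alpha>\<close> and look for radial solutions in the form \<open>u(r) = r\<^sup>-\<^sup>p w(ln r - \<tau>)\<close>. The equation
  becomes autonomous: \<open>w'' = c w' + \<beta> w - |w|\<^sup>\<alpha> w\<close> with \<open>c = 2p - (N - 2)\<close> and \<open>\<beta> = p (N - 2 - p)\<close>.
  The lower bound on \<open>\<alpha>\<close> says that \<open>\<beta> > 0\<close>, the upper bound that \<open>c > 0\<close>. So \<open>w\<close> moves in the
  double-well potential \<open>V(w) = |w|\<^sup>\<alpha>\<^sup>+\<^sup>2 / (\<alpha> + 2) - \<beta> w\<^sup>2 / 2\<close> with negative damping, and the energy
  \<open>E = w'\<^sup>2 / 2 + V(w)\<close> satisfies \<open>E' = c w'\<^sup>2 \<ge> 0\<close>.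

  An arbitrary open set of initial data in a well would not do: a solution with negative energy
  can tend to the saddle point \<open>0\<close> as \<open>s \<rightarrow> \<infinity>\<close> and stay positive. The family is therefore parametrised
  by the moment \<open>\<tau>\<close> and the place \<open>a\<close> at which the energy crosses zero: \<open>w(0) = a\<close> with
  \<open>0 < a < \<beta>\<^sup>1\<^sup>/\<^sup>\<alpha>\<close>, hence \<open>V(a) < 0\<close>, and \<open>w'(0) = sqrt (- 2 V(a)) \<noteq> 0\<close>. As the energy increases strictly through \<open>0\<close> at time \<open>0\<close>
  and vanishes at no other time, different parameters give different solutions.

  For \<open>s < 0\<close> the energy is negative and decreases as \<open>s \<rightarrow> - \<infinity>\<close>, so \<open>w\<close> keeps away from \<open>0\<close>, and
  \<open>u(r)\<close> is of exact order \<open>r\<^sup>-\<^sup>p\<close> at the origin: it is singular there, and since \<open>p + 2 < N\<close> it has the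
  required integrability (lemma \<open>away_from_zero_below\<close>).

  From \<open>s = 1\<close> on the energy is bounded below by a positive number. If \<open>w\<close> were eventually nonnegative,
  every critical point would be a strict maximum, so \<open>w\<close> would be eventually monotone; a finite limit
  is impossible because there is no equilibrium with positive energy, and an infinite limit is
  impossible because \<open>w'/w\<close> would satisfy a Riccati inequality that drives it to \<open>- \<infinity>\<close>
  (lemma \<open>oscillates\<close>). As \<open>E + const\<close> dominates \<open>(w\<^sup>2 + w'\<^sup>2) / 2\<close> and grows at most like \<open>e\<^sup>2\<^sup>c\<^sup>s\<close>,
  \<open>|w| \<le> const (1 + e\<^sup>c\<^sup>s)\<close>; this is the decay estimate for \<open>u\<close>, because \<open>c - p = - (N - 2 - p)\<close>.
  The same bound gives global existence (lemma \<open>global_solution\<close>): the nonlinearity can be cut off at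
  this height without affecting the solution, which makes it globally Lipschitz at each time, and then
  Picard iteration converges on the whole line (theorem \<open>picard_global\<close>).

  Away from the origin \<open>u\<close> solves the equation classically. To pass to distributions, multiply the
  vector field \<open>U \<nabla>\<phi> - \<phi> \<nabla>U\<close> by a cutoff that vanishes near \<open>0\<close>, integrate its divergence, and
  remove the cutoff by dominated convergence (theorem \<open>radial_distributional_solution\<close>). Everything is dominated by
  a multiple of \<open>|x|\<^sup>-\<^sup>p\<^sup>-\<^sup>2\<close>, which is locally integrable. The divergence theorem needed is only that a
  directional derivative of a compactly supported function has integral zero, which follows
  from translation invariance (lemma \<open>integral_directional_derivative_eq_0\<close>).
\<close>

section \<open>Global solutions of initial value problems\<close>

text \<open>
  The integral from \<open>0\<close> to \<open>s\<close> with orientation. The case distinction is essential: for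
  \<open>s < 0\<close> the interval \<open>{0..s}\<close> is empty.
\<close>
definition signed_integral :: "(real \<Rightarrow> 'a::banach) \<Rightarrow> real \<Rightarrow> 'a" where
  "signed_integral h s = (if 0 \<le> s then integral {0..s} h else - integral {s..0} h)"

lemma signed_integral_0 [simp]: "signed_integral h 0 = 0"
  by (simp add: signed_integral_def)

lemma has_vector_derivative_signed_integral:
  fixes h :: "real \<Rightarrow> 'a::banach"
  assumes h: "continuous_on UNIV h"
  shows "(signed_integral h has_vector_derivative h s) (at s)"
proof -
  define T where "T = \<bar>s\<bar> + 1"
  have hT: "continuous_on {a..b} h" for a b
    using h continuous_on_subset by blast
  have int: "h integrable_on {a..b}" for a b
    using hT integrable_continuous_real by blast
  have eq: "integral {-T..r} h - integral {-T..0} h = signed_integral h r" if "r \<in> {-T<..<T}" for r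
  proof (cases "0 \<le> r")
    case True
    have "integral {-T..0} h + integral {0..r} h = integral {-T..r} h"
      by (rule Henstock_Kurzweil_Integration.integral_combine) (use True int in \<open>auto simp: T_def\<close>)
    then show ?thesis using True by (simp add: signed_integral_def algebra_simps)
  next
    case False
    have "integral {-T..r} h + integral {r..0} h = integral {-T..0} h"
      by (rule Henstock_Kurzweil_Integration.integral_combine) (use False that int in auto)
    then show ?thesis using False by (simp add: signed_integral_def algebra_simps)
  qed
  have "((\<lambda>r. integral {-T..r} h) has_vector_derivative h s) (at s within {-T..T})"
    by (rule integral_has_vector_derivative[OF hT]) (auto simp: T_def)
  then have "((\<lambda>r. integral {-T..r} h) has_vector_derivative h s) (at s)"
    by (subst (asm) at_within_interior) (auto simp: T_def)
  then have "((\<lambda>r. integral {-T..r} h - integral {-T..0} h) has_vector_derivative (h s - 0)) (at s)"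
    by (intro derivative_intros)
  then have "((\<lambda>r. integral {-T..r} h - integral {-T..0} h) has_vector_derivative h s) (at s)"
    by simp
  then show ?thesis
    by (rule has_vector_derivative_transform_within_open[where S = "{-T<..<T}"])
       (use eq in \<open>auto simp: T_def\<close>)
qed

text \<open>
  One step of the Picard estimate: a bound of order \<open>n\<close> in time on the derivative becomes a bound of
  order \<open>n + 1\<close> on the function. Iterated, it produces the factorial that makes the iterates converge.
\<close>
lemma norm_le_of_derivative_power_bound_nonneg:
  fixes x :: "real \<Rightarrow> 'a::real_normed_vector"
  assumes der: "\<And>s. (x has_vector_derivative x' s) (at s)" and x0: "x 0 = 0"
    and bound: "\<And>s. 0 \<le> s \<Longrightarrow> s \<le> T \<Longrightarrow> norm (x' s) \<le> k * s ^ n"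
    and s: "0 \<le> s" "s \<le> T"
  shows "norm (x s) \<le> k * s ^ Suc n / real (Suc n)"
proof (cases "s = 0")
  case False
  have "norm (x s - x 0) \<le> k * s ^ Suc n / real (Suc n) - k * 0 ^ Suc n / real (Suc n)"
  proof (rule differentiable_bound_general[where f' = x' and \<phi>' = "\<lambda>s. k * s ^ n"])
    show "0 < s" using s False by simp
    show "continuous_on {0..s} x"
      using der by (meson continuous_at_imp_continuous_on has_vector_derivative_continuous)
    show "continuous_on {0..s} (\<lambda>s. k * s ^ Suc n / real (Suc n))"
      by (intro continuous_intros) auto
    fix t assume t: "0 < t" "t < s"
    show "(x has_vector_derivative x' t) (at t)" by (rule der)
    have "((\<lambda>s. k * s ^ Suc n / real (Suc n)) has_real_derivative (k * t ^ n)) (at t)"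
      by (rule derivative_eq_intros refl | simp)+
    then show "((\<lambda>s. k * s ^ Suc n / real (Suc n)) has_vector_derivative k * t ^ n) (at t)"
      by (simp add: has_real_derivative_iff_has_vector_derivative)
    show "norm (x' t) \<le> k * t ^ n" using bound t s by auto
  qed
  then show ?thesis by (simp add: x0)
qed (simp add: x0)

lemma norm_le_of_derivative_power_bound:
  fixes x :: "real \<Rightarrow> 'a::real_normed_vector"
  assumes der: "\<And>s. (x has_vector_derivative x' s) (at s)" and x0: "x 0 = 0"
    and bound: "\<And>s. \<bar>s\<bar> \<le> T \<Longrightarrow> norm (x' s) \<le> k * \<bar>s\<bar> ^ n"
    and s: "\<bar>s\<bar> \<le> T"
  shows "norm (x s) \<le> k * \<bar>s\<bar> ^ Suc n / real (Suc n)"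
proof (cases "0 \<le> s")
  case True
  have "norm (x' t) \<le> k * t ^ n" if "0 \<le> t" "t \<le> T" for t
    using bound[of t] that by simp
  from norm_le_of_derivative_power_bound_nonneg[OF der x0 this, of s s] show ?thesis
    using s True by (simp del: power_Suc)
next
  case False
  have der': "((\<lambda>s. x (- s)) has_vector_derivative - x' (- s)) (at s)" for s
  proof -
    have "(uminus has_vector_derivative - 1) (at s)"
      by (rule derivative_eq_intros refl)+
    from vector_diff_chain_at[OF this der] show ?thesis by (simp add: o_def)
  qed
  have "norm (- x' (- t)) \<le> k * t ^ n" if "0 \<le> t" "t \<le> T" for t
    using bound[of "- t"] that by simp
  from norm_le_of_derivative_power_bound_nonneg[OF der' _ this, of "- s" "- s"] show ?thesis
    using s False x0 by (simp del: power_Suc)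
qed

text \<open>
  Existence on the whole real line for a field whose Lipschitz constant may depend on time, but not on
  the state. The Picard iterates satisfy
  \<open>|X\<^sub>n\<^sub>+\<^sub>1 - X\<^sub>n| \<le> M L\<^sup>n |s|\<^sup>n\<^sup>+\<^sup>1 / (n + 1)!\<close> on each interval \<open>|s| \<le> T\<close>, so they and their derivatives converge uniformly
  there, however long the interval is.
\<close>
theorem picard_global:
  fixes F :: "real \<Rightarrow> 'a::banach \<Rightarrow> 'a"
  assumes cont: "\<And>x. continuous_on UNIV x \<Longrightarrow> continuous_on UNIV (\<lambda>s. F s (x s))"
    and lip: "\<And>T. \<exists>L\<ge>0. \<forall>s x y. \<bar>s\<bar> \<le> T \<longrightarrow> norm (F s x - F s y) \<le> L * norm (x - y)"
  obtains x where "x 0 = x\<^sub>0" "\<And>s. (x has_vector_derivative F s (x s)) (at s)"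
proof -
  define X where "X = rec_nat (\<lambda>s. x\<^sub>0) (\<lambda>n Y s. x\<^sub>0 + signed_integral (\<lambda>r. F r (Y r)) s)"
  have X0: "X 0 = (\<lambda>s. x\<^sub>0)" by (simp add: X_def)
  have XS: "X (Suc n) = (\<lambda>s. x\<^sub>0 + signed_integral (\<lambda>r. F r (X n r)) s)" for n by (simp add: X_def)
  have derX: "(X (Suc n) has_vector_derivative F s (X n s)) (at s)" if "continuous_on UNIV (X n)" for n s
  proof -
    have "((\<lambda>s. x\<^sub>0 + signed_integral (\<lambda>r. F r (X n r)) s) has_vector_derivative (0 + F s (X n s))) (at s)"
      by (intro derivative_intros has_vector_derivative_signed_integral cont that)
    then show ?thesis by (simp add: XS)
  qed
  have contX: "continuous_on UNIV (X n)" for n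
  proof (induction n)
    case (Suc n)
    show ?case
      using derX[OF Suc] by (meson continuous_at_imp_continuous_on has_vector_derivative_continuous)
  qed (simp add: X0)
  note derX = derX[OF contX]
  have X_0: "X n 0 = x\<^sub>0" for n by (cases n) (simp_all add: X0 XS)
  \<comment> \<open>The limit of the iterates, written as a telescoping series so that the Weierstrass test applies.\<close>
  define x where "x s = x\<^sub>0 + (\<Sum>n. X (Suc n) s - X n s)" for s
  have main: "uniform_limit {-T..T} X x sequentially
      \<and> uniform_limit {-T..T} (\<lambda>n s. F s (X n s)) (\<lambda>s. F s (x s)) sequentially" for T
  proof -
    obtain L where L: "L \<ge> 0" "\<And>s x y. \<bar>s\<bar> \<le> T \<Longrightarrow> norm (F s x - F s y) \<le> L * norm (x - y)"
      using lip by blast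
    have "bounded ((\<lambda>s. F s x\<^sub>0) ` {-T..T})"
      by (intro compact_imp_bounded compact_continuous_image compact_Icc
          continuous_on_subset[OF cont[of "\<lambda>_. x\<^sub>0"]]) auto
    then obtain M where M: "\<And>s. \<bar>s\<bar> \<le> T \<Longrightarrow> norm (F s x\<^sub>0) \<le> M"
      unfolding bounded_iff by (force simp: abs_le_iff)
    have step: "norm (X (Suc n) s - X n s) \<le> M * L ^ n * \<bar>s\<bar> ^ Suc n / fact (Suc n)"
      if "\<bar>s\<bar> \<le> T" for n s
      using that
    proof (induction n arbitrary: s)
      case 0
      have "norm (X 1 s - x\<^sub>0) \<le> M * \<bar>s\<bar> ^ Suc 0 / real (Suc 0)"
      proof (rule norm_le_of_derivative_power_bound[where T = T and x' = "\<lambda>s. F s x\<^sub>0"])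
        show "((\<lambda>s. X 1 s - x\<^sub>0) has_vector_derivative F s x\<^sub>0) (at s)" for s
          using has_vector_derivative_diff[OF derX[of 0 s] has_vector_derivative_const[of x\<^sub>0]]
          by (simp add: X0)
      qed (use 0 M X_0 in auto)
      then show ?case by (simp add: X0)
    next
      case (Suc n)
      have "norm (X (Suc (Suc n)) s - X (Suc n) s)
          \<le> (M * L ^ Suc n / fact (Suc n)) * \<bar>s\<bar> ^ Suc (Suc n) / real (Suc (Suc n))"
      proof (rule norm_le_of_derivative_power_bound[where T = T
              and x' = "\<lambda>s. F s (X (Suc n) s) - F s (X n s)"])
        show "((\<lambda>s. X (Suc (Suc n)) s - X (Suc n) s) has_vector_derivative
            F s (X (Suc n) s) - F s (X n s)) (at s)" for s
          by (intro has_vector_derivative_diff derX)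
        fix r assume r: "\<bar>r\<bar> \<le> T"
        have "norm (F r (X (Suc n) r) - F r (X n r)) \<le> L * norm (X (Suc n) r - X n r)"
          using L r by blast
        also have "\<dots> \<le> L * (M * L ^ n * \<bar>r\<bar> ^ Suc n / fact (Suc n))"
          using Suc.IH[OF r] L by (intro mult_left_mono)
        finally show "norm (F r (X (Suc n) r) - F r (X n r)) \<le> M * L ^ Suc n / fact (Suc n) * \<bar>r\<bar> ^ Suc n"
          by (simp add: mult_ac)
      qed (use Suc X_0 in auto)
      also have "\<dots> = M * L ^ Suc n * \<bar>s\<bar> ^ Suc (Suc n) / fact (Suc (Suc n))"
        by (simp add: fact_Suc[of "Suc n"] del: fact_Suc power_Suc)
      finally show ?case .
    qed
    have lim: "uniform_limit {-T..T} X x sequentially"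
    proof (cases "0 \<le> T")
      case True
      have M0: "0 \<le> M" using M[of 0] True order_trans[OF norm_ge_zero] by auto
      have step': "norm (X (Suc n) s - X n s) \<le> M * T * ((L * T) ^ n / fact n)" if "s \<in> {-T..T}" for n s
      proof -
        have s: "\<bar>s\<bar> \<le> T" using that by auto
        have "M * L ^ n * \<bar>s\<bar> ^ Suc n / fact (Suc n) \<le> M * L ^ n * T ^ Suc n / fact n"
          using s M0 L True by (intro frac_le mult_left_mono power_mono fact_mono) auto
        then show ?thesis using step[OF s, of n] by (simp add: power_mult_distrib mult_ac)
      qed
      have "summable (\<lambda>n. M * T * ((L * T) ^ n / fact n))"
        using summable_exp[of "L * T"] by (intro summable_mult) (simp add: field_simps)
      then have "uniform_limit {-T..T} (\<lambda>n s. \<Sum>i<n. X (Suc i) s - X i s)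
          (\<lambda>s. \<Sum>i. X (Suc i) s - X i s) sequentially"
        using step' by (intro Weierstrass_m_test) auto
      then have "uniform_limit {-T..T} (\<lambda>n s. x\<^sub>0 + (\<Sum>i<n. X (Suc i) s - X i s)) x sequentially"
        unfolding x_def by (intro uniform_limit_intros)
      moreover have "x\<^sub>0 + (\<Sum>i<n. X (Suc i) s - X i s) = X n s" for n s
        by (subst sum_lessThan_telescope) (simp add: X0)
      ultimately show ?thesis by simp
    qed simp
    moreover have "uniform_limit {-T..T} (\<lambda>n s. F s (X n s)) (\<lambda>s. F s (x s)) sequentially"
      unfolding uniform_limit_iff
    proof (intro allI impI)
      fix e :: real assume "e > 0"
      then have "0 < e / (L + 1)" using L by simp
      from uniform_limitD[OF lim this]
      show "\<forall>\<^sub>F n in sequentially. \<forall>s\<in>{-T..T}. dist (F s (X n s)) (F s (x s)) < e"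
      proof (eventually_elim, intro ballI)
        fix n s assume *: "\<forall>s\<in>{-T..T}. dist (X n s) (x s) < e / (L + 1)" and s: "s \<in> {-T..T}"
        have "dist (F s (X n s)) (F s (x s)) \<le> L * dist (X n s) (x s)"
          using L(2)[of s] s by (auto simp: dist_norm)
        also have "\<dots> \<le> (L + 1) * dist (X n s) (x s)" by (intro mult_right_mono) auto
        also have "\<dots> < e" using * s L by (auto simp: field_simps)
        finally show "dist (F s (X n s)) (F s (x s)) < e" .
      qed
    qed
    ultimately show ?thesis by blast
  qed
  have "x 0 = x\<^sub>0" by (simp add: x_def X_0)
  moreover have "(x has_vector_derivative F s (x s)) (at s)" for s
  proof -
    define T where "T = \<bar>s\<bar> + 1"
    \<comment> \<open>Differentiation of the limit: the derivatives \<open>F r (X n r)\<close> converge uniformly near \<open>s\<close>.\<close>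
    have "\<exists>g. \<forall>r\<in>{-T..T}. (\<lambda>n. X (Suc n) r) \<longlonglongrightarrow> g r \<and>
        (g has_derivative (\<lambda>h. h *\<^sub>R F r (x r))) (at r within {-T..T})"
    proof (rule has_derivative_sequence)
      show "(X (Suc n) has_derivative (\<lambda>h. h *\<^sub>R F r (X n r))) (at r within {-T..T})" for n r
        using has_vector_derivative_at_within[OF derX] by (simp add: has_vector_derivative_def)
      show "0 \<in> {-T..T}" by (simp add: T_def)
      show "(\<lambda>n. X (Suc n) 0) \<longlonglongrightarrow> x\<^sub>0" by (simp add: X_0)
      fix e :: real assume "e > 0"
      from uniform_limitD[OF conjunct2[OF main] this]
      show "\<forall>\<^sub>F n in sequentially. \<forall>r\<in>{-T..T}. \<forall>h. norm (h *\<^sub>R F r (X n r) - h *\<^sub>R F r (x r)) \<le> e * norm h"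
        by eventually_elim
           (auto simp: dist_norm mult.commute[of e] simp flip: scaleR_diff_right intro!: mult_left_mono dest!: bspec less_imp_le)
    qed auto
    then obtain g where g: "\<And>r. r \<in> {-T..T} \<Longrightarrow> (\<lambda>n. X (Suc n) r) \<longlonglongrightarrow> g r"
      and gd: "\<And>r. r \<in> {-T..T} \<Longrightarrow> (g has_derivative (\<lambda>h. h *\<^sub>R F r (x r))) (at r within {-T..T})"
      by blast
    have gx: "g r = x r" if "r \<in> {-T..T}" for r
      using g[OF that] LIMSEQ_Suc[OF tendsto_uniform_limitI[OF conjunct1[OF main] that]]
      by (rule LIMSEQ_unique)
    have "(g has_vector_derivative F s (x s)) (at s within {-T..T})"
      unfolding has_vector_derivative_def by (rule gd) (auto simp: T_def)
    then have "(g has_vector_derivative F s (x s)) (at s)"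
      by (subst (asm) at_within_interior) (auto simp: T_def)
    then show ?thesis
      by (rule has_vector_derivative_transform_within_open[where S = "{-T<..<T}"])
         (use gx in \<open>auto simp: T_def\<close>)
  qed
  ultimately show thesis using that by blast
qed

section \<open>Real functions of one variable\<close>

text \<open>
  The nonlinearity \<open>|x|\<^sup>\<alpha> x\<close> is \<open>C\<^sup>1\<close> on the whole line, including \<open>0\<close>, because \<open>\<alpha> > 0\<close>; at \<open>0\<close> the
  difference quotient is \<open>|h|\<^sup>\<alpha>\<close>.
\<close>
lemma signed_power_derivative:
  fixes \<alpha> x :: real
  assumes "\<alpha> > 0"
  shows "((\<lambda>x. \<bar>x\<bar> powr \<alpha> * x) has_real_derivative (\<alpha> + 1) * \<bar>x\<bar> powr \<alpha>) (at x)"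
proof -
  have nonzero: "((\<lambda>x. \<bar>x\<bar> powr \<alpha> * x) has_real_derivative (\<alpha> + 1) * \<bar>x\<bar> powr \<alpha>) (at x)"
    if "x > 0" for x
  proof -
    have "((\<lambda>x. x powr \<alpha> * x) has_real_derivative x powr \<alpha> * 1 + (\<alpha> * x powr (\<alpha> - 1)) * x) (at x)"
      using that by (intro DERIV_mult' has_real_derivative_powr DERIV_ident)
    also have "x powr \<alpha> * 1 + (\<alpha> * x powr (\<alpha> - 1)) * x = (\<alpha> + 1) * \<bar>x\<bar> powr \<alpha>"
      using that by (simp add: powr_diff algebra_simps)
    finally show ?thesis
      by (rule has_field_derivative_transform_within[where d = x]) (use that in \<open>auto simp: dist_real_def\<close>)
  qed
  consider "x > 0" | "x < 0" | "x = 0" by linarith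
  then show ?thesis
  proof cases
    case 1
    then show ?thesis by (rule nonzero)
  next
    case 2
    from nonzero[of "- x"] 2
    have "((\<lambda>y. \<bar>- y\<bar> powr \<alpha> * - y) has_real_derivative - ((\<alpha> + 1) * \<bar>x\<bar> powr \<alpha>)) (at x)"
      using DERIV_mirror[of "\<lambda>x. \<bar>x\<bar> powr \<alpha> * x" "(\<alpha> + 1) * \<bar>x\<bar> powr \<alpha>" x] by simp
    from DERIV_minus[OF this] show ?thesis by simp
  next
    case 3
    have "((\<lambda>h. \<bar>h\<bar> powr \<alpha>) \<longlongrightarrow> 0) (at (0::real))"
      using assms by (intro tendsto_eq_intros) auto
    then show ?thesis
      using 3 by (simp add: has_field_derivative_iff)
                 (auto elim!: Lim_transform_eventually simp: eventually_at_filter)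
  qed
qed

lemma first_zero:
  fixes f :: "real \<Rightarrow> real"
  assumes cont: "continuous_on {a..b} f" and "f a > 0" "f b \<le> 0" "a \<le> b"
  obtains z where "a < z" "z \<le> b" "f z = 0" "\<And>r. a \<le> r \<Longrightarrow> r < z \<Longrightarrow> f r > 0"
proof -
  define Z where "Z = {r \<in> {a..b}. f r = 0}"
  have zero: "\<exists>r. a \<le> r \<and> r \<le> t \<and> f r = 0" if "f t \<le> 0" "a \<le> t" "t \<le> b" for t
    using IVT2'[of f t 0 a] assms that continuous_on_subset[OF cont] by force
  have "closed Z"
    unfolding Z_def by (rule continuous_closed_preimage_constant[OF cont]) auto
  moreover have "Z \<noteq> {}" using zero[of b] assms by (auto simp: Z_def)
  moreover have bb: "bdd_below Z" by (rule bdd_belowI[of _ a]) (auto simp: Z_def)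
  ultimately have Inf: "Inf Z \<in> Z" by (intro closed_contains_Inf)
  show thesis
  proof (rule that[of "Inf Z"])
    show "a < Inf Z" using Inf assms by (cases "Inf Z = a") (auto simp: Z_def)
    fix r assume r: "a \<le> r" "r < Inf Z"
    show "f r > 0"
    proof (rule ccontr)
      assume "\<not> f r > 0"
      moreover have "r \<le> b" using r Inf by (auto simp: Z_def)
      ultimately obtain q where "a \<le> q" "q \<le> r" "f q = 0" using zero[of r] r by auto
      then have "q \<in> Z" using \<open>r \<le> b\<close> by (auto simp: Z_def)
      then have "Inf Z \<le> q" using bb by (rule cInf_lower)
      with \<open>q \<le> r\<close> r show False by simp
    qed
  qed (use Inf in \<open>auto simp: Z_def\<close>)
qed

text \<open>
  The continuity method: a strict inequality that improves itself cannot be lost. If \<open>f\<close> had a zero,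
  then at the zero nearest to \<open>0\<close> the hypothesis \<open>step\<close> would still apply. The segment from \<open>0\<close> to \<open>s\<close> is
  used so that both directions of time are treated at once.
\<close>
lemma positive_if_no_first_exit:
  fixes f :: "real \<Rightarrow> real"
  assumes cont: "continuous_on UNIV f" and "f 0 > 0"
    and step: "\<And>s. (\<And>r. r \<in> closed_segment 0 s \<Longrightarrow> f r \<ge> 0) \<Longrightarrow> f s > 0"
  shows "f s > 0"
proof (rule ccontr)
  assume "\<not> f s > 0"
  moreover have contf: "continuous_on {0..1} (\<lambda>t. f (t * s))"
    by (rule continuous_on_compose2[OF cont]) (auto intro: continuous_intros)
  ultimately obtain z where z: "0 < z" "z \<le> 1" "f (z * s) = 0"
    and pos: "\<And>t. 0 \<le> t \<Longrightarrow> t < z \<Longrightarrow> f (t * s) > 0"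
    using first_zero[of 0 1 "\<lambda>t. f (t * s)"] assms(2) contf by auto
  have "f (z * s) > 0"
  proof (rule step)
    fix r assume "r \<in> closed_segment 0 (z * s)"
    then obtain u where u: "0 \<le> u" "u \<le> 1" "r = u * z * s" by (auto simp: in_segment)
    show "f r \<ge> 0"
    proof (cases "u = 1")
      case False
      then have "u * z < z" using u z by simp
      then show ?thesis using pos[of "u * z"] u z by simp
    qed (use u z in simp)
  qed
  with z show False by simp
qed

lemma filterlim_at_top_of_derivative_ge:
  fixes f :: "real \<Rightarrow> real"
  assumes der: "\<And>s. s \<ge> S \<Longrightarrow> (f has_real_derivative f' s) (at s)"
    and ge: "\<forall>\<^sub>F s in at_top. f' s \<ge> m" and "m > 0"
  shows "filterlim f at_top at_top"
proof -
  obtain S1 where S1: "\<And>s. s \<ge> S1 \<Longrightarrow> f' s \<ge> m"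
    using ge by (auto simp: eventually_at_top_linorder)
  define S0 where "S0 = max S S1"
  have "f s \<ge> f S0 + m * (s - S0)" if "s \<ge> S0" for s
  proof -
    have "f S0 - m * S0 \<le> f s - m * s"
    proof (rule DERIV_nonneg_imp_nondecreasing[OF that])
      fix x assume "S0 \<le> x" "x \<le> s"
      then show "\<exists>y. ((\<lambda>s. f s - m * s) has_real_derivative y) (at x) \<and> 0 \<le> y"
        by (intro exI[of _ "f' x - m"] conjI)
           (auto intro!: derivative_eq_intros der S1 simp: S0_def)
    qed
    then show ?thesis by (simp add: algebra_simps)
  qed
  then have "\<forall>\<^sub>F s in at_top. f S0 + m * (s - S0) \<le> f s"
    by (auto simp: eventually_at_top_linorder)
  moreover have "filterlim (\<lambda>s. f S0 + m * (s - S0)) at_top at_top"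
    using \<open>m > 0\<close>
    by (intro filterlim_tendsto_add_at_top[OF tendsto_const]
        filterlim_tendsto_pos_mult_at_top[OF tendsto_const])
       (simp_all add: filterlim_tendsto_add_at_top[OF tendsto_const filterlim_ident, of "- S0", simplified])
  ultimately show ?thesis by (rule filterlim_at_top_mono[rotated])
qed

lemma monotone_bounded_tendsto_at_top:
  fixes f :: "real \<Rightarrow> real"
  assumes mono: "\<And>r s. S \<le> r \<Longrightarrow> r \<le> s \<Longrightarrow> f r \<le> f s"
    and bound: "\<And>s. S \<le> s \<Longrightarrow> f s \<le> M"
  obtains L where "(f \<longlongrightarrow> L) at_top" "f S \<le> L"
proof -
  define L where "L = Sup (f ` {S..})"
  have bdd: "bdd_above (f ` {S..})" using bound by (auto intro!: bdd_aboveI[of _ M])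
  have up: "f s \<le> L" if "S \<le> s" for s
    unfolding L_def using bdd that by (intro cSup_upper) auto
  have "(f \<longlongrightarrow> L) at_top"
  proof (rule order_tendstoI)
    fix a assume "a < L"
    then obtain t where "t \<ge> S" "a < f t"
      unfolding L_def using less_cSup_iff[OF _ bdd] by auto
    then show "\<forall>\<^sub>F x in at_top. a < f x"
      using mono by (auto simp: eventually_at_top_linorder intro!: exI[of _ t] intro: less_le_trans)
  next
    fix a assume "L < a"
    then show "\<forall>\<^sub>F x in at_top. f x < a"
      using up by (auto simp: eventually_at_top_linorder intro!: exI[of _ S] intro: le_less_trans)
  qed
  then show thesis using up[of S] that by simp
qed

section \<open>The oscillator with negative damping\<close>

text \<open>
  The equation \<open>w'' = c w' + force w\<close> as a first-order system for \<open>(w, v)\<close> with \<open>v = w'\<close>.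
\<close>
locale emden_fowler =
  fixes \<alpha> \<beta> c :: real
  assumes \<alpha>_pos: "\<alpha> > 0" and \<beta>_pos: "\<beta> > 0" and c_pos: "c > 0"
begin

definition force :: "real \<Rightarrow> real" where
  "force x = \<beta> * x - \<bar>x\<bar> powr \<alpha> * x"

definition potential :: "real \<Rightarrow> real" where
  "potential x = \<bar>x\<bar> powr \<alpha> * x * x / (\<alpha> + 2) - \<beta> * x\<^sup>2 / 2"

definition energy :: "(real \<Rightarrow> real) \<Rightarrow> (real \<Rightarrow> real) \<Rightarrow> real \<Rightarrow> real" where
  "energy w v s = (v s)\<^sup>2 / 2 + potential (w s)"

definition solves_at :: "(real \<Rightarrow> real) \<Rightarrow> (real \<Rightarrow> real) \<Rightarrow> real \<Rightarrow> bool" where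
  "solves_at w v s \<longleftrightarrow> (w has_real_derivative v s) (at s) \<and>
     (v has_real_derivative c * v s + force (w s)) (at s)"

lemma force_minus [simp]: "force (- x) = - force x"
  by (simp add: force_def)

lemma potential_minus [simp]: "potential (- x) = potential x"
  by (simp add: potential_def)

lemma force_derivative: "(force has_real_derivative \<beta> - (\<alpha> + 1) * \<bar>x\<bar> powr \<alpha>) (at x)"
  unfolding force_def[abs_def]
  by (rule derivative_eq_intros signed_power_derivative refl \<alpha>_pos | simp)+

lemma force_continuous [continuous_intros]:
  "continuous_on S f \<Longrightarrow> continuous_on S (\<lambda>x. force (f x))"
  by (rule continuous_on_compose2[of UNIV force])
     (auto intro: DERIV_continuous_on force_derivative)

lemma potential_derivative: "(potential has_real_derivative - force x) (at x)"
proof -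
  have "(potential has_real_derivative
      (((\<alpha> + 1) * \<bar>x\<bar> powr \<alpha>) * x + \<bar>x\<bar> powr \<alpha> * x) / (\<alpha> + 2) - \<beta> * x) (at x)"
  proof -
    have "((\<lambda>x. (\<bar>x\<bar> powr \<alpha> * x) * x) has_real_derivative
        (\<bar>x\<bar> powr \<alpha> * x) * 1 + ((\<alpha> + 1) * \<bar>x\<bar> powr \<alpha>) * x) (at x)"
      by (rule DERIV_mult'[OF signed_power_derivative[OF \<alpha>_pos] DERIV_ident])
    moreover have "((\<lambda>x. \<beta> * x\<^sup>2 / 2) has_real_derivative \<beta> * x) (at x)"
      by (rule derivative_eq_intros refl | simp)+
    ultimately show ?thesis
      unfolding potential_def[abs_def]
      by (intro DERIV_diff DERIV_cdivide) (simp_all add: add.commute)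
  qed
  also have "(((\<alpha> + 1) * \<bar>x\<bar> powr \<alpha>) * x + \<bar>x\<bar> powr \<alpha> * x) / (\<alpha> + 2) - \<beta> * x = - force x"
    using \<alpha>_pos by (simp add: force_def field_simps)
  finally show ?thesis .
qed

text \<open>
  The force is conservative, so only the (negative) damping term \<open>c v\<close> contributes to the energy balance.
\<close>
lemma energy_derivative:
  assumes "solves_at w v s"
  shows "(energy w v has_real_derivative c * (v s)\<^sup>2) (at s)"
proof -
  have w: "(w has_real_derivative v s) (at s)"
    and v: "(v has_real_derivative c * v s + force (w s)) (at s)"
    using assms by (auto simp: solves_at_def)
  have "((\<lambda>s. potential (w s)) has_real_derivative - force (w s) * v s) (at s)"
    by (rule DERIV_chain2[OF potential_derivative w])
  then have "(energy w v has_real_derivative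
      v s * (c * v s + force (w s)) + - force (w s) * v s) (at s)"
    unfolding energy_def[abs_def]
    by (auto intro!: derivative_eq_intros v)
  then show ?thesis by (simp add: algebra_simps power2_eq_square)
qed

text \<open>
  A constant \<open>K\<close> with \<open>potential x \<ge> x\<^sup>2 / 2 - K\<close>: the superlinear term of the potential beats
  \<open>(\<beta> + 1) x\<^sup>2 / 2\<close> once \<open>|x|\<^sup>\<alpha> \<ge> (\<alpha> + 2) (\<beta> + 1) / 2\<close>, and below this threshold \<open>K\<close> compensates.
\<close>
definition coercivity :: real where
  "coercivity = (\<beta> + 1) / 2 * (((\<alpha> + 2) * (\<beta> + 1) / 2) powr (1 / \<alpha>))\<^sup>2"

lemma coercivity_pos: "coercivity > 0"
  using \<alpha>_pos \<beta>_pos by (simp add: coercivity_def)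

lemma potential_coercive: "x\<^sup>2 / 2 - coercivity \<le> potential x"
proof (cases "\<bar>x\<bar> \<le> ((\<alpha> + 2) * (\<beta> + 1) / 2) powr (1 / \<alpha>)")
  case True
  then have "x\<^sup>2 \<le> (((\<alpha> + 2) * (\<beta> + 1) / 2) powr (1 / \<alpha>))\<^sup>2"
    using power_mono[of "\<bar>x\<bar>" _ 2] by simp
  then have "(\<beta> + 1) / 2 * x\<^sup>2 \<le> coercivity"
    unfolding coercivity_def using \<beta>_pos by (intro mult_left_mono) auto
  moreover have "0 \<le> \<bar>x\<bar> powr \<alpha> * (x * x) / (\<alpha> + 2)"
    using \<alpha>_pos by auto
  ultimately show ?thesis
    by (simp add: potential_def algebra_simps add_divide_distrib)
next
  case False
  have "(((\<alpha> + 2) * (\<beta> + 1) / 2) powr (1 / \<alpha>)) powr \<alpha> \<le> \<bar>x\<bar> powr \<alpha>"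
    using False \<alpha>_pos by (intro powr_mono2) auto
  then have "(\<alpha> + 2) * (\<beta> + 1) / 2 \<le> \<bar>x\<bar> powr \<alpha>"
    using \<alpha>_pos \<beta>_pos by (simp add: powr_powr)
  then have "((\<alpha> + 2) * (\<beta> + 1) / 2) * x\<^sup>2 \<le> \<bar>x\<bar> powr \<alpha> * x\<^sup>2"
    by (intro mult_right_mono) auto
  then have "(\<beta> + 1) / 2 * x\<^sup>2 \<le> \<bar>x\<bar> powr \<alpha> * x * x / (\<alpha> + 2)"
    using \<alpha>_pos by (simp add: field_simps power2_eq_square)
  then show ?thesis
    using coercivity_pos by (simp add: potential_def algebra_simps add_divide_distrib)
qed

lemma phase_bounded_by_energy: "(w s)\<^sup>2 + (v s)\<^sup>2 \<le> 2 * (energy w v s + coercivity)"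
  using potential_coercive[of "w s"] by (simp add: energy_def)

text \<open>
  The shifted energy \<open>e = E + K\<close> dominates \<open>(w\<^sup>2 + v\<^sup>2) / 2\<close>, and \<open>0 \<le> e' = c v\<^sup>2 \<le> 2 c e\<close>. So \<open>e\<close> grows
  at most exponentially forwards and does not grow backwards. The equation is required only between \<open>0\<close> and \<open>s\<close>,
  which is what the first-exit argument in the existence proof provides.
\<close>
lemma energy_growth:
  assumes sol: "\<And>r. r \<in> closed_segment 0 s \<Longrightarrow> solves_at w v r"
    and zero: "energy w v 0 = 0"
  shows "(w s)\<^sup>2 + (v s)\<^sup>2 \<le> 2 * coercivity * max 1 (exp (2 * c * s))"
proof -
  define e where "e r = energy w v r + coercivity" for r
  have e0: "e 0 = coercivity" by (simp add: e_def zero)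
  have de: "(e has_real_derivative c * (v r)\<^sup>2) (at r)" if "r \<in> closed_segment 0 s" for r
    unfolding e_def[abs_def] using energy_derivative[OF sol[OF that]]
    by (auto intro!: derivative_eq_intros)
  have ve: "(v r)\<^sup>2 \<le> 2 * e r" for r
    using phase_bounded_by_energy[of w r v] zero_le_power2[of "w r"] unfolding e_def by linarith
  have "e s \<le> coercivity * max 1 (exp (2 * c * s))"
  proof (cases "0 \<le> s")
    case True
    have "e s * exp (- 2 * c * s) \<le> e 0 * exp (- 2 * c * 0)"
    proof (rule DERIV_nonpos_imp_nonincreasing[OF True])
      fix r assume r: "0 \<le> r" "r \<le> s"
      have "((\<lambda>r. e r * exp (- 2 * c * r)) has_real_derivative
          c * (v r)\<^sup>2 * exp (- 2 * c * r) + e r * (exp (- 2 * c * r) * (- 2 * c))) (at r)"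
        using r by (auto intro!: derivative_eq_intros de simp: closed_segment_eq_real_ivl)
      moreover have "c * (v r)\<^sup>2 * exp (- 2 * c * r) + e r * (exp (- 2 * c * r) * (- 2 * c))
          = c * exp (- 2 * c * r) * ((v r)\<^sup>2 - 2 * e r)"
        by (simp add: algebra_simps)
      moreover have "\<dots> \<le> 0"
        using ve[of r] c_pos by (intro mult_nonneg_nonpos) auto
      ultimately show "\<exists>y. ((\<lambda>r. e r * exp (- 2 * c * r)) has_real_derivative y) (at r) \<and> y \<le> 0"
        by metis
    qed
    then have "e s \<le> coercivity * exp (2 * c * s)"
      by (simp add: e0 exp_minus field_simps)
    also have "\<dots> \<le> coercivity * max 1 (exp (2 * c * s))"
      using coercivity_pos by (intro mult_left_mono) auto
    finally show ?thesis .
  next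
    case False
    have "e s \<le> e 0"
    proof (rule DERIV_nonneg_imp_nondecreasing[of s 0 e])
      fix r assume "s \<le> r" "r \<le> 0"
      then have "(e has_real_derivative c * (v r)\<^sup>2) (at r)"
        by (intro de) (simp add: closed_segment_eq_real_ivl)
      moreover have "0 \<le> c * (v r)\<^sup>2" using c_pos by simp
      ultimately show "\<exists>y. (e has_real_derivative y) (at r) \<and> 0 \<le> y" by blast
    qed (use False in simp)
    also have "\<dots> \<le> coercivity * max 1 (exp (2 * c * s))"
      unfolding e0 using coercivity_pos by simp
    finally show ?thesis .
  qed
  then have "2 * e s \<le> 2 * (coercivity * max 1 (exp (2 * c * s)))" by simp
  with phase_bounded_by_energy[of w s v] show ?thesis
    unfolding e_def by (simp only: mult.assoc)
qed

lemma force_lipschitz: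
  assumes "\<bar>x\<bar> \<le> M" "\<bar>y\<bar> \<le> M"
  shows "\<bar>force x - force y\<bar> \<le> (\<beta> + (\<alpha> + 1) * M powr \<alpha>) * \<bar>x - y\<bar>"
proof -
  have "norm (force x - force y) \<le> (\<beta> + (\<alpha> + 1) * M powr \<alpha>) * norm (x - y)"
  proof (rule field_differentiable_bound[of "{-M..M}"])
    fix z assume "z \<in> {-M..M}"
    then have "\<bar>z\<bar> powr \<alpha> \<le> M powr \<alpha>" using \<alpha>_pos by (intro powr_mono2) auto
    then have "(\<alpha> + 1) * \<bar>z\<bar> powr \<alpha> \<le> (\<alpha> + 1) * M powr \<alpha>"
      using \<alpha>_pos by (intro mult_left_mono) auto
    moreover have "0 \<le> (\<alpha> + 1) * \<bar>z\<bar> powr \<alpha>" using \<alpha>_pos by simp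
    ultimately show "norm (\<beta> - (\<alpha> + 1) * \<bar>z\<bar> powr \<alpha>) \<le> \<beta> + (\<alpha> + 1) * M powr \<alpha>"
      using \<beta>_pos by (auto simp: abs_le_iff)
  qed (use assms in \<open>auto intro: DERIV_subset force_derivative\<close>)
  then show ?thesis by simp
qed

text \<open>
  A strict upper bound for \<open>|w|\<close> and \<open>|v|\<close> along solutions with zero energy at time \<open>0\<close>. It is
  chosen strictly larger than the energy estimate gives, so that it can also serve as cutoff height.
\<close>
definition envelope :: "real \<Rightarrow> real" where
  "envelope s = sqrt (2 * coercivity) * (1 + exp (c * s))"

lemma envelope_pos: "envelope s > 0"
  using coercivity_pos by (simp add: envelope_def add_pos_pos)

lemma below_envelope:
  assumes "x\<^sup>2 \<le> 2 * coercivity * max 1 (exp (2 * c * s))"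
  shows "\<bar>x\<bar> < envelope s"
proof -
  have "exp (2 * c * s) = (exp (c * s))\<^sup>2"
    using exp_double[of "c * s"] by (simp add: mult.assoc)
  moreover have "0 < exp (c * s)" by simp
  ultimately have "max 1 (exp (2 * c * s)) < (1 + exp (c * s))\<^sup>2"
    unfolding power2_sum max_less_iff_conj by (simp add: add_pos_pos)
  then have "2 * coercivity * max 1 (exp (2 * c * s)) < 2 * coercivity * (1 + exp (c * s))\<^sup>2"
    using coercivity_pos by (intro mult_strict_left_mono) auto
  also have "\<dots> = (envelope s)\<^sup>2"
    using coercivity_pos by (simp add: envelope_def power_mult_distrib)
  finally have "\<bar>x\<bar>\<^sup>2 < (envelope s)\<^sup>2"
    using assms by simp
  then show ?thesis
    by (rule power2_less_imp_less) (simp add: envelope_pos less_imp_le)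
qed

text \<open>
  The nonlinearity is only locally Lipschitz. Clipping its argument at the envelope makes it Lipschitz
  at every time, so the clipped equation is solvable on the whole line. As long as the solution is
  below the envelope it solves the original equation, and then the energy estimate keeps it strictly below.
\<close>
lemma global_solution:
  assumes zero: "b\<^sup>2 / 2 + potential a = 0"
  obtains w v where "w 0 = a" "v 0 = b" "\<And>s. solves_at w v s"
proof -
  define clip where "clip s x = max (- envelope s) (min (envelope s) x)" for s x
  have clip_le: "\<bar>clip s x\<bar> \<le> envelope s" for s x
    using envelope_pos[of s] by (auto simp: clip_def)
  have clip_id: "clip s x = x" if "\<bar>x\<bar> \<le> envelope s" for s x
    using that by (auto simp: clip_def)
  have clip_lip: "\<bar>clip s x - clip s y\<bar> \<le> \<bar>x - y\<bar>" for s x y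
    by (auto simp: clip_def)
  define F :: "real \<Rightarrow> real \<times> real \<Rightarrow> real \<times> real" where
    "F s z = (snd z, c * snd z + force (clip s (fst z)))" for s z
  obtain z where z0: "z 0 = (a, b)" and zd: "\<And>s. (z has_vector_derivative F s (z s)) (at s)"
  proof (rule picard_global[where F = F and x\<^sub>0 = "(a, b)"])
    fix x :: "real \<Rightarrow> real \<times> real" assume "continuous_on UNIV x"
    then show "continuous_on UNIV (\<lambda>s. F s (x s))"
      unfolding F_def clip_def envelope_def by (intro continuous_intros)
  next
    fix T :: real
    define M where "M = envelope T"
    define L where "L = \<beta> + (\<alpha> + 1) * M powr \<alpha>"
    have L0: "L \<ge> 0" using \<alpha>_pos \<beta>_pos by (simp add: L_def)
    have "norm (F s x - F s y) \<le> (1 + c + L) * norm (x - y)" if s: "\<bar>s\<bar> \<le> T" for s x y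
    proof -
      have "envelope s \<le> M"
        unfolding M_def envelope_def using s c_pos coercivity_pos by (intro mult_left_mono) auto
      then have "\<bar>force (clip s (fst x)) - force (clip s (fst y))\<bar>
          \<le> L * \<bar>clip s (fst x) - clip s (fst y)\<bar>"
        unfolding L_def using clip_le by (intro force_lipschitz) (meson order_trans)+
      also have "\<dots> \<le> L * \<bar>fst x - fst y\<bar>"
        using L0 clip_lip by (intro mult_left_mono)
      also have "\<dots> \<le> L * norm (x - y)"
        using L0 norm_fst_le[of "fst (x - y)" "snd (x - y)"]
        by (intro mult_left_mono) (simp_all only: prod.collapse real_norm_def flip: fst_diff)
      finally have 1: "\<bar>force (clip s (fst x)) - force (clip s (fst y))\<bar> \<le> L * norm (x - y)" .
      have 2: "\<bar>snd x - snd y\<bar> \<le> norm (x - y)"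
        using norm_snd_le[of "snd (x - y)" "fst (x - y)"]
        by (simp only: prod.collapse real_norm_def flip: snd_diff)
      have "norm (F s x - F s y) = norm (snd x - snd y,
          c * (snd x - snd y) + (force (clip s (fst x)) - force (clip s (fst y))))"
        by (simp add: F_def algebra_simps)
      also have "\<dots> \<le> \<bar>snd x - snd y\<bar>
          + \<bar>c * (snd x - snd y) + (force (clip s (fst x)) - force (clip s (fst y)))\<bar>"
        using norm_Pair_le by (metis real_norm_def)
      also have "\<dots> \<le> \<bar>snd x - snd y\<bar> + (c * \<bar>snd x - snd y\<bar>
          + \<bar>force (clip s (fst x)) - force (clip s (fst y))\<bar>)"
        using abs_triangle_ineq[of "c * (snd x - snd y)"] c_pos by (simp add: abs_mult)
      also have "\<dots> \<le> norm (x - y) + (c * norm (x - y) + L * norm (x - y))"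
        using 1 2 c_pos by (intro add_mono mult_left_mono) auto
      finally show ?thesis by (simp add: algebra_simps)
    qed
    then show "\<exists>L\<ge>0. \<forall>s x y. \<bar>s\<bar> \<le> T \<longrightarrow> norm (F s x - F s y) \<le> L * norm (x - y)"
      using L0 c_pos by (intro exI[of _ "1 + c + L"]) auto
  qed blast
  define w where "w s = fst (z s)" for s
  define v where "v s = snd (z s)" for s
  have dw: "(w has_real_derivative v s) (at s)" for s
    using bounded_linear.has_vector_derivative[OF bounded_linear_fst zd[of s]]
    by (simp add: has_real_derivative_iff_has_vector_derivative w_def[abs_def] v_def F_def)
  have dv: "(v has_real_derivative c * v s + force (clip s (w s))) (at s)" for s
    using bounded_linear.has_vector_derivative[OF bounded_linear_snd zd[of s]]
    by (simp add: has_real_derivative_iff_has_vector_derivative w_def v_def[abs_def] F_def)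
  have sol: "solves_at w v s" if "\<bar>w s\<bar> \<le> envelope s" for s
    using dw dv[of s] clip_id[OF that] by (simp add: solves_at_def)
  have e0: "energy w v 0 = 0"
    using zero by (simp add: energy_def w_def v_def z0)
  have inside: "envelope s - \<bar>w s\<bar> > 0"
    if "\<And>r. r \<in> closed_segment 0 s \<Longrightarrow> envelope r - \<bar>w r\<bar> \<ge> 0" for s
  proof -
    have "(w s)\<^sup>2 + (v s)\<^sup>2 \<le> 2 * coercivity * max 1 (exp (2 * c * s))"
      using that by (intro energy_growth sol e0) auto
    then have "(w s)\<^sup>2 \<le> 2 * coercivity * max 1 (exp (2 * c * s))"
      using zero_le_power2[of "v s"] by linarith
    from below_envelope[OF this] show ?thesis by simp
  qed
  have "envelope s - \<bar>w s\<bar> > 0" for s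
  proof (rule positive_if_no_first_exit[of "\<lambda>s. envelope s - \<bar>w s\<bar>"])
    have "continuous_on UNIV w" by (rule DERIV_continuous_on) (rule dw)
    then show "continuous_on UNIV (\<lambda>s. envelope s - \<bar>w s\<bar>)"
      unfolding envelope_def by (intro continuous_intros)
    have "a\<^sup>2 \<le> 2 * coercivity"
      using potential_coercive[of a] zero zero_le_power2[of b] by linarith
    then show "envelope 0 - \<bar>w 0\<bar> > 0"
      using below_envelope[of a 0] by (simp add: w_def z0)
  qed (rule inside)
  then have "solves_at w v s" for s
    using sol[of s] by (simp add: less_imp_le)
  then show thesis
    using that[of w v] by (simp add: w_def v_def z0)
qed

text \<open>
  Positive potential energy at \<open>x > 0\<close> means that \<open>x\<close> lies beyond the well, where the force points
  back. At a critical point of \<open>w\<close> with positive energy this says \<open>w'' < 0\<close>.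
\<close>
lemma force_neg_if_potential_pos:
  assumes "potential x > 0" "x \<ge> 0"
  shows "force x < 0"
proof -
  have x: "x > 0" using assms by (cases "x = 0") (auto simp: potential_def)
  have "potential x = x\<^sup>2 * (\<bar>x\<bar> powr \<alpha> / (\<alpha> + 2) - \<beta> / 2)"
    by (simp add: potential_def power2_eq_square algebra_simps)
  with assms x have "\<bar>x\<bar> powr \<alpha> / (\<alpha> + 2) > \<beta> / 2"
    by (simp add: zero_less_mult_iff)
  then have "\<bar>x\<bar> powr \<alpha> > \<beta> * (\<alpha> + 2) / 2"
    using \<alpha>_pos by (simp add: field_simps)
  moreover have "\<beta> * (\<alpha> + 2) / 2 \<ge> \<beta>" using \<alpha>_pos \<beta>_pos by (simp add: field_simps)
  ultimately have "\<bar>x\<bar> powr \<alpha> > \<beta>" by linarith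
  moreover have "force x = x * (\<beta> - \<bar>x\<bar> powr \<alpha>)" by (simp add: force_def algebra_simps)
  ultimately show ?thesis using x by (simp add: mult_pos_neg)
qed

lemma potential_nonpos_at_equilibrium:
  assumes "force x = 0"
  shows "potential x \<le> 0"
proof (cases "x = 0")
  case False
  then have "\<bar>x\<bar> powr \<alpha> = \<beta>" using assms by (auto simp: force_def)
  then have "potential x = x\<^sup>2 * \<beta> * (1 / (\<alpha> + 2) - 1 / 2)"
    by (simp add: potential_def power2_eq_square algebra_simps)
  moreover have "1 / (\<alpha> + 2) - 1 / 2 \<le> 0" using \<alpha>_pos by (simp add: field_simps)
  ultimately show ?thesis using \<beta>_pos by (simp add: mult_nonneg_nonpos)
qed (simp add: potential_def)

text \<open>
  Every zero of \<open>v\<close> is a downward crossing, by \<open>force_neg_if_potential_pos\<close>. So once \<open>v\<close> is negative it stays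
  negative.
\<close>
lemma velocity_eventually_of_one_sign:
  assumes sol: "\<And>s. solves_at w v s" and pos: "E\<^sub>1 > 0"
    and energy: "\<And>s. s \<ge> S \<Longrightarrow> energy w v s \<ge> E\<^sub>1"
    and nonneg: "\<And>s. s \<ge> S \<Longrightarrow> w s \<ge> 0"
  obtains S' where "S' \<ge> S" "(\<forall>s\<ge>S'. v s > 0) \<or> (\<forall>s\<ge>S'. v s < 0)"
proof -
  have dv: "(v has_real_derivative c * v s + force (w s)) (at s)" for s
    using sol by (simp add: solves_at_def)
  have cont: "continuous_on A v" for A
    by (rule DERIV_continuous_on) (rule has_field_derivative_at_within[OF dv])
  have falling: "c * v s + force (w s) < 0" if "v s = 0" "s \<ge> S" for s
    using force_neg_if_potential_pos[of "w s"] energy[of s] nonneg[of s] that pos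
    by (simp add: energy_def)
  have stays: "v s\<^sub>1 < 0" if s0: "s\<^sub>0 \<ge> S" "v s\<^sub>0 < 0" and s1: "s\<^sub>1 \<ge> s\<^sub>0" for s\<^sub>0 s\<^sub>1
  proof (rule ccontr)
    assume "\<not> v s\<^sub>1 < 0"
    then obtain z where z: "s\<^sub>0 < z" "v z = 0" and before: "\<And>r. s\<^sub>0 \<le> r \<Longrightarrow> r < z \<Longrightarrow> v r < 0"
      using first_zero[of s\<^sub>0 s\<^sub>1 "\<lambda>s. - v s"] s0 s1 cont[of "{s\<^sub>0..s\<^sub>1}"]
      by (auto intro: continuous_intros)
    obtain d where d: "d > 0" "\<And>h. h > 0 \<Longrightarrow> h < d \<Longrightarrow> v z < v (z - h)"
      using DERIV_neg_dec_left[OF dv falling[of z]] z s0 by auto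
    define h where "h = min (d / 2) (z - s\<^sub>0)"
    have "h > 0" "h < d" "s\<^sub>0 \<le> z - h" using d(1) z by (auto simp: h_def)
    with d(2)[of h] before[of "z - h"] z show False by simp
  qed
  show thesis
  proof (cases "\<forall>s\<ge>S. v s > 0")
    case True
    then show thesis using that[of S] by simp
  next
    case False
    then obtain s\<^sub>0 where s0: "s\<^sub>0 \<ge> S" "v s\<^sub>0 \<le> 0" by (auto simp: not_less)
    have "\<exists>s\<^sub>1\<ge>S. v s\<^sub>1 < 0"
    proof (cases "v s\<^sub>0 = 0")
      case True
      then obtain d where "d > 0" "\<And>h. h > 0 \<Longrightarrow> h < d \<Longrightarrow> v (s\<^sub>0 + h) < v s\<^sub>0"
        using DERIV_neg_dec_right[OF dv falling[of s\<^sub>0]] s0 by auto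
      then have "v (s\<^sub>0 + d / 2) < 0" using True by force
      then show ?thesis using s0 \<open>d > 0\<close> by (intro exI[of _ "s\<^sub>0 + d / 2"]) auto
    qed (use s0 in force)
    then show thesis using stays that by blast
  qed
qed

text \<open>
  If \<open>w \<rightarrow> L\<close>, then \<open>(v - c w)' = force w \<rightarrow> force L\<close>. If \<open>force L \<noteq> 0\<close>, this makes \<open>v\<close> and hence \<open>w\<close>
  unbounded. If \<open>force L = 0\<close>, then \<open>L\<close> is an equilibrium, whose potential is at most \<open>0\<close>; all the
  energy must then be kinetic, so \<open>|v|\<close> is bounded below and \<open>w\<close> is again unbounded.
\<close>
lemma no_finite_limit:
  assumes sol: "\<And>s. solves_at w v s" and pos: "E\<^sub>1 > 0"
    and energy: "\<And>s. s \<ge> S \<Longrightarrow> energy w v s \<ge> E\<^sub>1"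
    and sign: "(\<forall>s\<ge>S. v s > 0) \<or> (\<forall>s\<ge>S. v s < 0)"
  shows "\<not> (w \<longlongrightarrow> L) at_top"
proof
  assume lim: "(w \<longlongrightarrow> L) at_top"
  have dw: "(w has_real_derivative v s) (at s)"
    and dv: "(v has_real_derivative c * v s + force (w s)) (at s)" for s
    using sol by (auto simp: solves_at_def)
  have not_up: "\<not> filterlim w at_top at_top"
    using not_tendsto_and_filterlim_at_infinity[OF _ lim] filterlim_at_top_imp_at_infinity by auto
  have not_down: "\<not> filterlim (\<lambda>s. - w s) at_top at_top"
    using not_tendsto_and_filterlim_at_infinity[OF _ tendsto_minus[OF lim]]
      filterlim_at_top_imp_at_infinity by auto
  have v_ge: False if "\<forall>\<^sub>F s in at_top. v s \<ge> m" "m > 0" for m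
    using filterlim_at_top_of_derivative_ge[of 0 w v] dw that not_up by blast
  have v_le: False if "\<forall>\<^sub>F s in at_top. - v s \<ge> m" "m > 0" for m
    using filterlim_at_top_of_derivative_ge[of 0 "\<lambda>s. - w s" "\<lambda>s. - v s"] DERIV_minus[OF dw] that not_down
    by blast
  have force_lim: "((\<lambda>s. force (w s)) \<longlongrightarrow> force L) at_top"
    using isCont_tendsto_compose[OF DERIV_isCont[OF force_derivative] lim] .
  have dh: "((\<lambda>s. v s - c * w s) has_real_derivative force (w s)) (at s)" for s
    using DERIV_diff[OF dv DERIV_cmult[OF dw, of c]] by simp
  have cw: "((\<lambda>s. c * w s) \<longlongrightarrow> c * L) at_top" by (intro tendsto_intros lim)
  show False
  proof (cases "force L" "0 :: real" rule: linorder_cases)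
    case equal
    then have "potential L < E\<^sub>1 / 2" using potential_nonpos_at_equilibrium[of L] pos by linarith
    moreover have "((\<lambda>s. potential (w s)) \<longlongrightarrow> potential L) at_top"
      using isCont_tendsto_compose[OF DERIV_isCont[OF potential_derivative] lim] .
    ultimately have "\<forall>\<^sub>F s in at_top. potential (w s) < E\<^sub>1 / 2"
      by (rule order_tendstoD(2)[rotated])
    moreover have "\<forall>\<^sub>F s in at_top. s \<ge> S" by (rule eventually_ge_at_top)
    ultimately have ev: "\<forall>\<^sub>F s in at_top. s \<ge> S \<and> sqrt E\<^sub>1 \<le> \<bar>v s\<bar>"
    proof eventually_elim
      case (elim s)
      then have "E\<^sub>1 \<le> (v s)\<^sup>2" using energy[of s] by (simp add: energy_def)
      then show ?case using elim by (simp add: real_le_rsqrt real_sqrt_le_iff real_le_lsqrt flip: real_sqrt_abs)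
    qed
    from sign show False
    proof
      assume "\<forall>s\<ge>S. v s > 0"
      with ev have "\<forall>\<^sub>F s in at_top. v s \<ge> sqrt E\<^sub>1" by (auto elim!: eventually_mono)
      from v_ge[OF this] pos show False by simp
    next
      assume "\<forall>s\<ge>S. v s < 0"
      with ev have "\<forall>\<^sub>F s in at_top. - v s \<ge> sqrt E\<^sub>1" by (auto elim!: eventually_mono)
      from v_le[OF this] pos show False by simp
    qed
  next
    case greater
    then have "\<forall>\<^sub>F s in at_top. force (w s) \<ge> force L / 2"
      using order_tendstoD(1)[OF force_lim, of "force L / 2"] by (auto elim: eventually_mono)
    then have "filterlim (\<lambda>s. v s - c * w s) at_top at_top"
      by (rule filterlim_at_top_of_derivative_ge[OF dh]) (use greater in simp)
    from filterlim_tendsto_add_at_top[OF cw this] have "filterlim v at_top at_top" by simp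
    then have "\<forall>\<^sub>F s in at_top. v s \<ge> 1" by (simp add: filterlim_at_top)
    from v_ge[OF this] show False by simp
  next
    case less
    then have "\<forall>\<^sub>F s in at_top. - force (w s) \<ge> - force L / 2"
      using order_tendstoD(2)[OF force_lim, of "force L / 2"] by (auto elim: eventually_mono)
    then have "filterlim (\<lambda>s. - (v s - c * w s)) at_top at_top"
      by (rule filterlim_at_top_of_derivative_ge[OF DERIV_minus[OF dh]]) (use less in simp)
    from filterlim_tendsto_add_at_top[OF tendsto_minus[OF cw] this]
    have "filterlim (\<lambda>s. - v s) at_top at_top" by (simp add: algebra_simps)
    then have "\<forall>\<^sub>F s in at_top. - v s \<ge> 1" by (simp only: filterlim_at_top)
    from v_le[OF this] show False by simp
  qed
qed

text \<open>
  The logarithmic derivative \<open>z = v / w\<close> satisfies \<open>z' = c z - z\<^sup>2 + \<beta> - w\<^sup>\<alpha>\<close>. As \<open>c z - z\<^sup>2\<close> is bounded above, \<open>w\<^sup>\<alpha> \<rightarrow> \<infinity>\<close>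
  makes \<open>z' \<le> - 1\<close> eventually, and \<open>z\<close> cannot stay positive. This is where superlinearity enters.
\<close>
lemma not_increasing_to_infinity:
  assumes sol: "\<And>s. solves_at w v s" and lim: "filterlim w at_top at_top"
  shows "\<not> (\<forall>s\<ge>S. v s > 0)"
proof
  assume v: "\<forall>s\<ge>S. v s > 0"
  have dw: "(w has_real_derivative v s) (at s)"
    and dv: "(v has_real_derivative c * v s + force (w s)) (at s)" for s
    using sol by (auto simp: solves_at_def)
  have w1: "\<forall>\<^sub>F s in at_top. w s \<ge> 1" and w2: "\<forall>\<^sub>F s in at_top. w s \<ge> (c\<^sup>2 + \<beta> + 1) powr (1 / \<alpha>)"
    using lim by (simp_all add: filterlim_at_top)
  from w1 obtain S\<^sub>0 where S0: "\<And>s. s \<ge> S\<^sub>0 \<Longrightarrow> w s \<ge> 1"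
    by (auto simp: eventually_at_top_linorder)
  define z where "z s = v s / w s" for s
  define z' where "z' s = c * z s + \<beta> - w s powr \<alpha> - (z s)\<^sup>2" for s
  have dz: "((\<lambda>s. - z s) has_real_derivative - z' s) (at s)" if "s \<ge> S\<^sub>0" for s
  proof -
    have w: "w s > 0" using S0[OF that] by simp
    have "(z has_real_derivative ((c * v s + force (w s)) * w s - v s * v s) / (w s * w s)) (at s)"
      unfolding z_def[abs_def] using w by (intro DERIV_divide dv dw) simp
    also have "((c * v s + force (w s)) * w s - v s * v s) / (w s * w s) = z' s"
      using w by (simp add: z'_def z_def force_def field_simps power2_eq_square)
    finally show ?thesis by (rule DERIV_minus)
  qed
  have "\<forall>\<^sub>F s in at_top. - z' s \<ge> 1"
    using w1 w2
  proof eventually_elim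
    case (elim s)
    have "((c\<^sup>2 + \<beta> + 1) powr (1 / \<alpha>)) powr \<alpha> \<le> w s powr \<alpha>"
      using elim \<alpha>_pos by (intro powr_mono2) auto
    then have "c\<^sup>2 + \<beta> + 1 \<le> w s powr \<alpha>"
      using \<alpha>_pos \<beta>_pos by (simp add: powr_powr add_nonneg_pos)
    moreover have "c * z s - (z s)\<^sup>2 \<le> c\<^sup>2"
      using sum_squares_bound[of c "z s"] zero_le_power2[of c] zero_le_power2[of "z s"] by linarith
    ultimately show ?case by (simp add: z'_def)
  qed
  from filterlim_at_top_of_derivative_ge[OF dz this]
  have "\<forall>\<^sub>F s in at_top. - z s \<ge> 1" by (simp only: filterlim_at_top)
  moreover have "\<forall>\<^sub>F s in at_top. - z s < 1"
    using eventually_ge_at_top[of S] eventually_ge_at_top[of S\<^sub>0]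
  proof eventually_elim
    case (elim s)
    then have "z s > 0" using v S0[of s] by (simp add: z_def)
    then show ?case by simp
  qed
  ultimately have "\<forall>\<^sub>F s in at_top :: real filter. False"
    by eventually_elim simp
  then show False by simp
qed

lemma takes_negative_values:
  assumes sol: "\<And>s. solves_at w v s" and pos: "E\<^sub>1 > 0"
    and energy: "\<And>s. s \<ge> S \<Longrightarrow> energy w v s \<ge> E\<^sub>1"
  shows "\<exists>s>R. w s < 0"
proof (rule ccontr)
  assume "\<not> (\<exists>s>R. w s < 0)"
  then have nonneg: "w s \<ge> 0" if "s > R" for s using that by force
  have dw: "(w has_real_derivative v s) (at s)" for s
    using sol by (auto simp: solves_at_def)
  define S\<^sub>1 where "S\<^sub>1 = max S (R + 1)"
  obtain S' where S': "S' \<ge> S\<^sub>1" and sign: "(\<forall>s\<ge>S'. v s > 0) \<or> (\<forall>s\<ge>S'. v s < 0)"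
    by (rule velocity_eventually_of_one_sign[OF sol pos, of S\<^sub>1]) (auto simp: S\<^sub>1_def intro: energy nonneg)
  have no_limit: "\<not> (w \<longlongrightarrow> L) at_top" for L
    by (rule no_finite_limit[OF sol pos _ sign]) (use S' in \<open>auto simp: S\<^sub>1_def intro: energy\<close>)
  from sign show False
  proof
    assume up: "\<forall>s\<ge>S'. v s > 0"
    have mono: "w r \<le> w s" if "S' \<le> r" "r \<le> s" for r s
      using that up by (intro DERIV_nonneg_imp_nondecreasing[of r s w]) (auto intro!: exI[of _ "v _"] dw less_imp_le)
    have "filterlim w at_top at_top"
      unfolding filterlim_at_top
    proof
      fix M
      obtain t where "t \<ge> S'" "w t > M"
        using monotone_bounded_tendsto_at_top[of S' w M] mono no_limit by (meson not_le)
      then show "\<forall>\<^sub>F s in at_top. M \<le> w s"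
        using mono by (auto simp: eventually_at_top_linorder intro!: exI[of _ t] intro: order_trans less_imp_le)
    qed
    from not_increasing_to_infinity[OF sol this] up show False by blast
  next
    assume down: "\<forall>s\<ge>S'. v s < 0"
    have mono: "- w r \<le> - w s" if "S' \<le> r" "r \<le> s" for r s
      using that down DERIV_nonpos_imp_nonincreasing[of r s w] dw
      by (force intro: less_imp_le)
    obtain L where "((\<lambda>s. - w s) \<longlongrightarrow> L) at_top"
      using monotone_bounded_tendsto_at_top[of S' "\<lambda>s. - w s" 0] mono nonneg S'
      by (force simp: S\<^sub>1_def)
    from tendsto_minus[OF this] no_limit show False by simp
  qed
qed

text \<open>
  The equation is odd, so nonnegative and nonpositive tails are excluded by the same argument.
\<close>
lemma oscillates:
  assumes sol: "\<And>s. solves_at w v s" and pos: "E\<^sub>1 > 0"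
    and energy: "\<And>s. s \<ge> S \<Longrightarrow> energy w v s \<ge> E\<^sub>1"
  shows "(\<exists>s>R. w s > 0) \<and> (\<exists>s>R. w s < 0)"
proof
  show "\<exists>s>R. w s < 0" using sol pos energy by (rule takes_negative_values)
  have "solves_at (\<lambda>s. - w s) (\<lambda>s. - v s) s" for s
    using sol[of s] DERIV_minus[of w "v s" s] DERIV_minus[of v "c * v s + force (w s)" s]
    by (simp add: solves_at_def)
  from takes_negative_values[OF this pos, of S R] energy show "\<exists>s>R. w s > 0"
    by (simp add: energy_def)
qed

text \<open>
  Monotonicity alone gives weak inequalities. They are strict because the energy has a positive
  derivative at time \<open>0\<close>.
\<close>
lemma energy_sign:
  assumes sol: "\<And>s. solves_at w v s" and "energy w v 0 = 0" "v 0 \<noteq> 0"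
  shows "s < 0 \<Longrightarrow> energy w v s < 0" and "s > 0 \<Longrightarrow> energy w v s > 0"
    and "r \<le> s \<Longrightarrow> energy w v r \<le> energy w v s"
proof -
  have mono: "energy w v r \<le> energy w v s" if "r \<le> s" for r s
    using that energy_derivative[OF sol] c_pos
    by (intro DERIV_nonneg_imp_nondecreasing[of r s "energy w v"]) (auto intro!: exI mult_nonneg_nonneg)
  then show "r \<le> s \<Longrightarrow> energy w v r \<le> energy w v s" .
  have d0: "c * (v 0)\<^sup>2 > 0" using assms c_pos by simp
  show "energy w v s < 0" if "s < 0"
  proof -
    obtain d where d: "d > 0" "\<And>h. h > 0 \<Longrightarrow> h < d \<Longrightarrow> energy w v (0 - h) < energy w v 0"
      using DERIV_pos_inc_left[OF energy_derivative[OF sol] d0] by blast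
    have "energy w v s \<le> energy w v (0 - min (d / 2) (- s))" using d that by (intro mono) auto
    also have "\<dots> < energy w v 0" using d that by (intro d(2)) auto
    finally show ?thesis using assms by simp
  qed
  show "energy w v s > 0" if "s > 0"
  proof -
    obtain d where d: "d > 0" "\<And>h. h > 0 \<Longrightarrow> h < d \<Longrightarrow> energy w v (0 + h) > energy w v 0"
      using DERIV_pos_inc_right[OF energy_derivative[OF sol] d0] by blast
    have "energy w v 0 < energy w v (0 + min (d / 2) s)" using d that by (intro d(2)) auto
    also have "\<dots> \<le> energy w v s" using d that by (intro mono) auto
    finally show ?thesis using assms by simp
  qed
qed

text \<open>
  For \<open>s \<le> - 1\<close> the potential energy is at most \<open>E(-1) < 0\<close>, and \<open>V(w) \<ge> - \<beta> w\<^sup>2 / 2\<close>.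
\<close>
lemma away_from_zero_below:
  assumes sol: "\<And>s. solves_at w v s" and "energy w v 0 = 0" "v 0 \<noteq> 0"
  obtains \<delta> where "\<delta> > 0" "\<And>s. s \<le> - 1 \<Longrightarrow> \<bar>w s\<bar> \<ge> \<delta>"
proof -
  define e where "e = - energy w v (- 1)"
  have e: "e > 0" using energy_sign(1)[OF assms, of "-1"] by (simp add: e_def)
  have "\<bar>w s\<bar> \<ge> sqrt (2 * e / \<beta>)" if "s \<le> - 1" for s
  proof -
    have "potential (w s) \<le> - e"
      using energy_sign(3)[OF assms that] zero_le_power2[of "v s"]
      unfolding e_def energy_def[of w v s] by linarith
    moreover have "\<bar>w s\<bar> powr \<alpha> * (w s * w s) / (\<alpha> + 2) \<ge> 0" using \<alpha>_pos by simp
    ultimately have "e \<le> \<beta> * (w s)\<^sup>2 / 2" by (simp add: potential_def mult.assoc)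
    then have "2 * e / \<beta> \<le> (w s)\<^sup>2" using \<beta>_pos by (simp add: field_simps)
    then have "sqrt (2 * e / \<beta>) \<le> sqrt ((w s)\<^sup>2)" by (rule real_sqrt_le_mono)
    then show ?thesis by simp
  qed
  then show thesis using that[of "sqrt (2 * e / \<beta>)"] e \<beta>_pos by simp
qed

lemma potential_negative:
  assumes "0 < a" "a < \<beta> powr (1 / \<alpha>)"
  shows "potential a < 0"
proof -
  have "a powr \<alpha> < (\<beta> powr (1 / \<alpha>)) powr \<alpha>" using assms \<alpha>_pos by (intro powr_less_mono2) auto
  then have "a powr \<alpha> < \<beta>" using \<alpha>_pos \<beta>_pos by (simp add: powr_powr)
  then have "a powr \<alpha> / (\<alpha> + 2) < \<beta> / 2"
    using \<alpha>_pos \<beta>_pos assms by (intro frac_less2) (auto intro: less_imp_le)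
  moreover have "potential a = a\<^sup>2 * (a powr \<alpha> / (\<alpha> + 2) - \<beta> / 2)"
    using assms by (simp add: potential_def power2_eq_square algebra_simps)
  ultimately show ?thesis using assms by (simp add: mult_pos_neg)
qed

definition zero_energy_orbit :: "real \<Rightarrow> (real \<Rightarrow> real) \<Rightarrow> (real \<Rightarrow> real) \<Rightarrow> bool" where
  "zero_energy_orbit a w v \<longleftrightarrow>
     (\<forall>s. solves_at w v s) \<and> w 0 = a \<and> v 0 \<noteq> 0 \<and> energy w v 0 = 0"

lemma zero_energy_orbit_exists:
  assumes "0 < a" "a < \<beta> powr (1 / \<alpha>)"
  shows "\<exists>w v. zero_energy_orbit a w v"
proof -
  define b where "b = sqrt (- 2 * potential a)"
  have neg: "potential a < 0" using assms by (rule potential_negative)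
  then have b: "b\<^sup>2 / 2 + potential a = 0" "b \<noteq> 0" by (simp_all add: b_def)
  obtain w v where "w 0 = a" "v 0 = b" "\<And>s. solves_at w v s"
    using global_solution[OF b(1)] by blast
  then show ?thesis
    unfolding zero_energy_orbit_def using b by (auto simp: energy_def)
qed

lemma zero_energy_orbit_oscillates:
  assumes "zero_energy_orbit a w v"
  shows "(\<exists>s>R. w s > 0) \<and> (\<exists>s>R. w s < 0)"
  using assms energy_sign[of w v] unfolding zero_energy_orbit_def
  by (intro oscillates[where v = v and E\<^sub>1 = "energy w v 1" and S = 1]) auto

lemma zero_energy_orbit_bound:
  assumes "zero_energy_orbit a w v"
  shows "\<bar>w s\<bar> < envelope s" and "\<bar>v s\<bar> < envelope s"
proof -
  have *: "(w s)\<^sup>2 + (v s)\<^sup>2 \<le> 2 * coercivity * max 1 (exp (2 * c * s))"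
    using assms by (intro energy_growth) (auto simp: zero_energy_orbit_def)
  show "\<bar>w s\<bar> < envelope s"
    using * zero_le_power2[of "v s"] by (intro below_envelope) linarith
  show "\<bar>v s\<bar> < envelope s"
    using * zero_le_power2[of "w s"] by (intro below_envelope) linarith
qed

text \<open>
  The shift is determined by the only time at which the energy vanishes. The velocity, hence the energy, is
  recovered from \<open>w\<close> by differentiation.
\<close>
lemma zero_energy_orbit_translates:
  assumes 1: "zero_energy_orbit a w v" and 2: "zero_energy_orbit a' w' v'"
    and eq: "\<And>s. w (s - \<tau>) = w' (s - \<tau>')"
  shows "a = a' \<and> \<tau> = \<tau>'"
proof -
  have dw: "(w has_real_derivative v s) (at s)" and dw': "(w' has_real_derivative v' s) (at s)" for s
    using 1 2 by (auto simp: zero_energy_orbit_def solves_at_def)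
  define \<sigma> where "\<sigma> = \<tau> - \<tau>'"
  have w: "w = (\<lambda>s. w' (s + \<sigma>))"
    using eq[of "_ + \<tau>"] by (auto simp: \<sigma>_def algebra_simps)
  have v: "v s = v' (s + \<sigma>)" for s
  proof -
    have "((\<lambda>s. w' (s + \<sigma>)) has_real_derivative v' (s + \<sigma>) * 1) (at s)"
      by (rule DERIV_chain2[OF dw']) (auto intro!: derivative_eq_intros)
    then show ?thesis using dw[of s] DERIV_unique unfolding w by force
  qed
  have "energy w' v' \<sigma> = energy w v 0"
    by (simp add: energy_def v) (simp add: w)
  also have "\<dots> = 0" using 1 by (simp add: zero_energy_orbit_def)
  finally have "\<sigma> = 0"
    using energy_sign(1,2)[of w' v' \<sigma>] 2 unfolding zero_energy_orbit_def by (cases \<sigma> "0::real" rule: linorder_cases) auto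
  moreover from this have "a = a'" using 1 2 w by (simp add: zero_energy_orbit_def)
  ultimately show ?thesis by (simp add: \<sigma>_def)
qed

lemma zero_energy_orbit_continuous:
  assumes "zero_energy_orbit a w v"
  shows "continuous_on S w" "continuous_on S v"
proof -
  have dw: "(w has_real_derivative v s) (at s)"
    and dv: "(v has_real_derivative c * v s + force (w s)) (at s)" for s
    using assms by (auto simp: zero_energy_orbit_def solves_at_def)
  show "continuous_on S w" by (rule DERIV_continuous_on[OF has_field_derivative_at_within[OF dw]])
  show "continuous_on S v" by (rule DERIV_continuous_on[OF has_field_derivative_at_within[OF dv]])
qed

end

section \<open>Integrals near a point singularity\<close>

text \<open>
  Decompose the ball into dyadic shells. On the shell between radii \<open>R / 2\<^sup>k\<^sup>+\<^sup>1\<close> and \<open>R / 2\<^sup>k\<close> the function is at most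
  its value at the inner radius, and the volume is at most that of the outer ball, so the integral is
  bounded by a geometric series with ratio \<open>2\<^sup>\<gamma>\<^sup>-\<^sup>N < 1\<close>.
\<close>
lemma integrable_norm_powr_cball:
  fixes \<gamma> :: real
  assumes \<gamma>: "0 \<le> \<gamma>" "\<gamma> < DIM('a::euclidean_space)" and R: "R > 0"
  shows "integrable lborel (\<lambda>x::'a. norm x powr - \<gamma> * indicator (cball 0 R) x)"
proof -
  define r where "r k = R / 2 ^ k" for k :: nat
  define N where "N = DIM('a)"
  define V where "V = unit_ball_vol (real N)"
  have r_pos: "r k > 0" for k using R by (simp add: r_def)
  have V0: "V \<ge> 0" by (simp add: V_def)
  define t where "t k = r (Suc k) powr - \<gamma> * (V * r k ^ N)" for k
  have t_eq: "t k = (R powr - \<gamma> * 2 powr \<gamma> * V * R ^ N) * (2 powr (\<gamma> - N)) ^ k" for k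
  proof -
    have "r (Suc k) powr - \<gamma> = R powr - \<gamma> * 2 powr (\<gamma> * (k + 1))"
      unfolding r_def using R
      by (simp add: powr_divide powr_minus powr_powr mult.commute[of \<gamma>] divide_simps del: power_Suc flip: powr_realpow)
    moreover have "r k ^ N = R ^ N * 2 powr (- (real N * k))"
      unfolding r_def by (simp add: power_divide powr_minus divide_simps powr_powr flip: powr_realpow power_mult)
         (simp add: mult.commute)
    ultimately have "t k = R powr - \<gamma> * V * R ^ N * (2 powr (\<gamma> * (k + 1)) * 2 powr (- (real N * k)))"
      by (simp add: t_def)
    also have "2 powr (\<gamma> * (k + 1)) * 2 powr (- (real N * k)) = 2 powr \<gamma> * (2 powr (\<gamma> - N)) powr k"
      unfolding powr_powr powr_add[symmetric] by (simp add: algebra_simps)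
    also have "(2 powr (\<gamma> - N)) powr k = (2 powr (\<gamma> - N)) ^ k"
      by (simp add: powr_realpow)
    finally show ?thesis by simp
  qed
  have t_summable: "summable t"
    unfolding t_eq using \<gamma> by (intro summable_mult summable_geometric) (simp add: N_def powr_less_one)
  have t_pos: "t k \<ge> 0" for k using V0 r_pos[of k] by (simp add: t_def less_imp_le)
  have le: "ennreal (norm x powr - \<gamma> * indicator (cball 0 R) x)
      \<le> (\<Sum>k. ennreal (r (Suc k) powr - \<gamma>) * indicator (cball 0 (r k)) x)" for x :: 'a
  proof (cases "x \<noteq> 0 \<and> norm x \<le> R")
    case True
    define k where "k = (LEAST n. r n < norm x)"
    have ex: "\<exists>n. r n < norm x"
    proof -
      obtain n where "(1 / 2) ^ n < norm x / R"
        using real_arch_pow_inv[of "norm x / R" "1/2"] True R by auto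
      then show ?thesis using R by (auto simp: r_def field_simps power_divide intro!: exI[of _ n])
    qed
    have k: "r k < norm x" unfolding k_def using ex by (rule LeastI_ex)
    have "k \<noteq> 0"
    proof
      assume "k = 0"
      then show False using k True by (simp add: r_def)
    qed
    then obtain j where j: "k = Suc j" using not0_implies_Suc by blast
    have "\<not> r j < norm x"
      using not_less_Least[of j "\<lambda>n. r n < norm x"] j unfolding k_def by linarith
    then have x: "norm x \<le> r j" by simp
    have "norm x powr - \<gamma> \<le> r (Suc j) powr - \<gamma>"
      using k r_pos[of k] \<gamma> unfolding j[symmetric] by (intro powr_mono2') auto
    then have "ennreal (norm x powr - \<gamma> * indicator (cball 0 R) x)
        \<le> ennreal (r (Suc j) powr - \<gamma>) * indicator (cball 0 (r j)) x"
      using True x by (simp add: ennreal_leI)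
    also have "\<dots> \<le> (\<Sum>k. ennreal (r (Suc k) powr - \<gamma>) * indicator (cball 0 (r k)) x)"
      using sum_le_suminf[OF summableI, of "{j}"
          "\<lambda>k. ennreal (r (Suc k) powr - \<gamma>) * indicator (cball 0 (r k)) x"]
      by (simp only: sum.insert sum.empty finite.intros empty_iff not_False_eq_True add_0_right zero_le simp_thms)
    finally show ?thesis .
  qed auto
  have "(\<integral>\<^sup>+x. ennreal (norm x powr - \<gamma> * indicator (cball 0 R) x) \<partial>(lborel :: 'a measure))
     \<le> (\<integral>\<^sup>+x. (\<Sum>k. ennreal (r (Suc k) powr - \<gamma>) * indicator (cball 0 (r k)) x) \<partial>(lborel :: 'a measure))"
    by (intro nn_integral_mono le)
  also have "\<dots> = (\<Sum>k. \<integral>\<^sup>+x. ennreal (r (Suc k) powr - \<gamma>) * indicator (cball 0 (r k)) x \<partial>(lborel :: 'a measure))"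
    by (intro nn_integral_suminf borel_measurable_times_ennreal borel_measurable_indicator) auto
  also have "\<dots> = (\<Sum>k. ennreal (t k))"
  proof (rule suminf_cong)
    fix k
    have "(\<integral>\<^sup>+x. ennreal (r (Suc k) powr - \<gamma>) * indicator (cball 0 (r k)) x \<partial>(lborel :: 'a measure))
        = ennreal (r (Suc k) powr - \<gamma>) * emeasure lborel (cball 0 (r k) :: 'a set)"
      by (rule nn_integral_cmult_indicator) simp
    then show "(\<integral>\<^sup>+x. ennreal (r (Suc k) powr - \<gamma>) * indicator (cball 0 (r k)) x \<partial>(lborel :: 'a measure))
        = ennreal (t k)"
      using r_pos[of k] V0 by (simp add: emeasure_cball less_imp_le t_def V_def N_def ennreal_mult)
  qed
  also have "\<dots> < \<infinity>"
    using ennreal_suminf_neq_top[OF t_summable t_pos] by (simp add: less_top)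
  finally have fin: "(\<integral>\<^sup>+x. ennreal (norm x powr - \<gamma> * indicator (cball 0 R) x) \<partial>(lborel :: 'a measure)) < \<infinity>" .
  have "(\<lambda>x::'a. norm x powr - \<gamma> * indicator (cball 0 R) x) \<in> borel_measurable lborel"
    by (intro borel_measurable_times borel_measurable_indicator) auto
  then show ?thesis
    using fin by (intro integrableI_nonneg) auto
qed

lemma integrable_of_norm_powr_bound:
  fixes g :: "'a::euclidean_space \<Rightarrow> real" and \<gamma> :: real
  assumes \<gamma>: "0 \<le> \<gamma>" "\<gamma> < DIM('a)" and g: "g \<in> borel_measurable borel"
    and bound: "\<And>x. \<bar>g x\<bar> \<le> C * (norm x powr - \<gamma> * indicator (cball 0 R) x)"
  shows "integrable lborel g"
proof -
  have "integrable lborel (\<lambda>x::'a. norm x powr - \<gamma> * indicator (cball 0 (max R 1)) x)"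
    by (rule integrable_norm_powr_cball[OF \<gamma>]) simp
  then have "integrable lborel (\<lambda>x::'a. \<bar>C\<bar> * (norm x powr - \<gamma> * indicator (cball 0 (max R 1)) x))"
    by (rule integrable_mult_right)
  then show ?thesis
  proof (rule Bochner_Integration.integrable_bound)
    show "g \<in> borel_measurable lborel" using g by simp
    have "norm (g x) \<le> norm (\<bar>C\<bar> * (norm x powr - \<gamma> * indicator (cball 0 (max R 1)) x))" for x
    proof (cases "norm x \<le> R")
      case True
      then show ?thesis
        using bound[of x] mult_right_mono[OF abs_ge_self, of "norm x powr - \<gamma>" C]
        by (simp add: abs_mult)
    next
      case False
      then show ?thesis using bound[of x] by simp
    qed
    then show "AE x in lborel. norm (g x) \<le> norm (\<bar>C\<bar> * (norm x powr - \<gamma> * indicator (cball 0 (max R 1)) x))"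
      by simp
  qed
qed

lemma Lp_loc_of_norm_powr_bound:
  fixes f :: "'a::euclidean_space \<Rightarrow> real" and \<gamma> :: real
  assumes \<gamma>: "0 \<le> \<gamma>" "\<gamma> < DIM('a)" and f: "f \<in> borel_measurable borel"
    and bound: "\<And>R. \<exists>C. \<forall>x. norm x \<le> R \<longrightarrow> \<bar>f x\<bar> powr p \<le> C * norm x powr - \<gamma>"
  shows "Lp_loc p f"
  unfolding Lp_loc_def
proof (intro conjI allI impI)
  show "f \<in> borel_measurable lebesgue" using f by (simp add: measurable_completion)
  fix K :: "'a set" assume K: "compact K"
  then obtain R where R: "\<And>x. x \<in> K \<Longrightarrow> norm x \<le> R"
    using compact_imp_bounded[OF K] by (auto simp: bounded_iff)
  obtain C where C: "\<And>x. norm x \<le> R \<Longrightarrow> \<bar>f x\<bar> powr p \<le> C * norm x powr - \<gamma>"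
    using bound by blast
  have [measurable]: "K \<in> sets borel" using K by (simp add: borel_compact)
  have "(\<lambda>x. indicator K x *\<^sub>R \<bar>f x\<bar> powr p) \<in> borel_measurable borel"
    using f by measurable
  moreover have "\<bar>indicator K x *\<^sub>R \<bar>f x\<bar> powr p\<bar> \<le> \<bar>C\<bar> * (norm x powr - \<gamma> * indicator (cball 0 R) x)" for x
  proof (cases "x \<in> K")
    case True
    then show ?thesis
      using C[of x] R[of x] mult_right_mono[OF abs_ge_self, of "norm x powr - \<gamma>" C] by simp
  qed simp
  ultimately have "integrable lborel (\<lambda>x. indicator K x *\<^sub>R \<bar>f x\<bar> powr p)"
    by (rule integrable_of_norm_powr_bound[OF \<gamma>])
  then show "set_integrable lebesgue K (\<lambda>x. \<bar>f x\<bar> powr p)"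
    unfolding set_integrable_def by (subst integrable_completion) auto
qed

text \<open>
  The difference quotients \<open>n (g (x + b / n) - g x)\<close> have integral zero by translation invariance of
  Lebesgue measure, they are bounded by \<open>M\<close> by the mean value theorem, and they live in a fixed ball.
  Dominated convergence gives the claim.
\<close>
lemma integral_directional_derivative_eq_0:
  fixes g D :: "'a::euclidean_space \<Rightarrow> real"
  assumes der: "\<And>x. (g has_derivative g' x) (at x)" and D: "\<And>x. D x = g' x b"
    and bound: "\<And>x. \<bar>D x\<bar> \<le> M" and supp: "\<And>x. norm x > R \<Longrightarrow> g x = 0"
  shows "integrable lborel D" and "integral\<^sup>L lborel D = 0"
proof -
  have line: "((\<lambda>t. g (x + t *\<^sub>R b)) has_real_derivative D (x + t *\<^sub>R b)) (at t)" for x t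
  proof -
    have "((\<lambda>t. x + t *\<^sub>R b) has_derivative (\<lambda>h. h *\<^sub>R b)) (at t)"
      by (auto intro!: derivative_eq_intros)
    from has_derivative_compose[OF this der]
    have "((\<lambda>t. g (x + t *\<^sub>R b)) has_derivative (\<lambda>h. g' (x + t *\<^sub>R b) (h *\<^sub>R b))) (at t)" .
    moreover have "g' y (h *\<^sub>R b) = D y * h" for y h
      using linear_scale[OF has_derivative_linear[OF der]] by (simp add: D)
    ultimately show ?thesis by (simp add: has_field_derivative_def)
  qed
  have cont: "continuous_on UNIV g"
    by (rule has_derivative_continuous_on[OF has_derivative_at_withinI[OF der]])
  then have g_meas[measurable]: "g \<in> borel_measurable borel"
    by (rule borel_measurable_continuous_onI)
  have "integrable lborel (\<lambda>x. indicator (cball 0 R) x *\<^sub>R g x)"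
    by (rule borel_integrable_compact) (auto intro: continuous_on_subset[OF cont])
  then have g_int: "integrable lborel g"
    by (rule Bochner_Integration.integrable_cong[THEN iffD1, rotated -1])
       (use supp in \<open>auto simp: indicator_def not_le\<close>)
  have M0: "M \<ge> 0" using bound[of 0] abs_ge_zero[of "D 0"] by linarith
  define q where "q n x = real (Suc n) * (g (x + (1 / real (Suc n)) *\<^sub>R b) - g x)" for n x
  have q_meas[measurable]: "q n \<in> borel_measurable borel" for n
    unfolding q_def by measurable
  have translate: "integrable lborel (\<lambda>x. g (x + a)) \<and> integral\<^sup>L lborel (\<lambda>x. g (x + a)) = integral\<^sup>L lborel g" for a
  proof -
    have d: "lborel = distr lborel borel (\<lambda>x::'a. a + x)"
      using lborel_affine[of 1 a] by (simp add: density_1)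
    have "integrable (distr lborel borel (\<lambda>x::'a. a + x)) g" using g_int d by simp
    then have "integrable lborel (\<lambda>x. g (a + x))"
      by (subst (asm) integrable_distr_eq) auto
    moreover have "integral\<^sup>L (distr lborel borel (\<lambda>x::'a. a + x)) g = integral\<^sup>L lborel (\<lambda>x. g (a + x))"
      by (rule integral_distr) auto
    ultimately show ?thesis using d by (simp add: add.commute)
  qed
  have q_int0: "integral\<^sup>L lborel (q n) = 0" for n
    unfolding q_def using translate g_int by simp
  have q_lim: "(\<lambda>n. q n x) \<longlonglongrightarrow> D x" for x
  proof -
    have "((\<lambda>h. (g (x + h *\<^sub>R b) - g x) / h) \<longlongrightarrow> D x) (at 0)"
      using line[of x 0] by (simp add: has_field_derivative_iff)
    moreover have "filterlim (\<lambda>n. 1 / real (Suc n)) (at 0) sequentially"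
      unfolding filterlim_at using lim_1_over_n[THEN LIMSEQ_Suc] by simp
    ultimately have "(\<lambda>n. (g (x + (1 / real (Suc n)) *\<^sub>R b) - g x) / (1 / real (Suc n))) \<longlonglongrightarrow> D x"
      by (rule filterlim_compose)
    then show ?thesis by (simp add: q_def mult.commute)
  qed
  have q_bound: "\<bar>q n x\<bar> \<le> M * indicator (cball 0 (R + norm b)) x" for n x
  proof (cases "norm x \<le> R + norm b")
    case True
    define h where "h = 1 / real (Suc n)"
    have h: "h > 0" by (simp add: h_def)
    have "norm (g (x + h *\<^sub>R b) - g (x + 0 *\<^sub>R b)) \<le> M * norm (h - 0)"
      by (rule field_differentiable_bound[of "UNIV :: real set" "\<lambda>t. g (x + t *\<^sub>R b)" "\<lambda>t. D (x + t *\<^sub>R b)"])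
         (use line bound in auto)
    then have "real (Suc n) * \<bar>g (x + h *\<^sub>R b) - g x\<bar> \<le> real (Suc n) * (M * h)"
      using h by (intro mult_left_mono) auto
    also have "\<dots> = M" by (simp add: h_def)
    finally show ?thesis
      using True by (simp add: q_def abs_mult h_def del: of_nat_Suc)
  next
    case False
    have "norm ((1 / real (Suc n)) *\<^sub>R b) \<le> norm b"
      using mult_left_mono[of 1 "1 + real n" "norm b"] by (simp add: divide_simps)
    then have "norm (x + (1 / real (Suc n)) *\<^sub>R b) > R"
      using False norm_triangle_ineq4[of "x + (1 / real (Suc n)) *\<^sub>R b" "(1 / real (Suc n)) *\<^sub>R b"] by simp
    moreover have "norm x > R" using False norm_ge_zero[of b] by linarith
    ultimately show ?thesis using False supp by (simp add: q_def)
  qed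
  have D_meas: "D \<in> borel_measurable lborel"
    by (rule borel_measurable_LIMSEQ_real[OF q_lim]) simp
  have w: "integrable lborel (\<lambda>x::'a. M * indicator (cball 0 (R + norm b)) x)"
    by (intro integrable_mult_right integrable_real_indicator emeasure_bounded_finite) auto
  have q_meas': "q n \<in> borel_measurable lborel" for n by simp
  have dom: "norm (q n x) \<le> M * indicator (cball 0 (R + norm b)) x" for n x
    using q_bound by simp
  show "integrable lborel D"
    by (rule integrable_dominated_convergence[OF D_meas q_meas' w AE_I2 AE_I2]) (rule q_lim dom)+
  have "(\<lambda>n. integral\<^sup>L lborel (q n)) \<longlonglongrightarrow> integral\<^sup>L lborel D"
    by (rule integral_dominated_convergence[OF D_meas q_meas' w AE_I2 AE_I2]) (rule q_lim dom)+
  then show "integral\<^sup>L lborel D = 0"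
    unfolding q_int0 by (rule LIMSEQ_unique[OF _ tendsto_const])
qed

section \<open>Radial functions with a point singularity\<close>

text \<open>
  The square makes the positive part differentiable, so that it can be used to build a \<open>C\<^sup>1\<close> cutoff.
\<close>
lemma positive_part_square_derivative:
  "((\<lambda>y::real. (max 0 y)\<^sup>2) has_real_derivative 2 * max 0 y) (at y)"
proof -
  consider "y > 0" | "y < 0" | "y = 0" by linarith
  then show ?thesis
  proof cases
    case 1
    have "((\<lambda>y. y\<^sup>2) has_real_derivative 2 * max 0 y) (at y)"
      using 1 by (auto intro!: derivative_eq_intros)
    then show ?thesis
      by (rule has_field_derivative_transform_within_open[of _ _ _ "{0<..}"]) (use 1 in auto)
  next
    case 2
    have "((\<lambda>y. 0) has_real_derivative 2 * max 0 y) (at y)"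
      using 2 by (auto intro!: derivative_eq_intros)
    then show ?thesis
      by (rule has_field_derivative_transform_within_open[of _ _ _ "{..<0}"]) (use 2 in auto)
  next
    case 3
    have "((\<lambda>h::real. (max 0 h)\<^sup>2 / h) \<longlongrightarrow> 0) (at 0)"
    proof (rule Lim_null_comparison)
      have "norm ((max 0 h)\<^sup>2 / h) \<le> \<bar>h\<bar>" for h :: real
        by (cases "h > 0") (auto simp: power2_eq_square max_def)
      then show "\<forall>\<^sub>F h in at 0. norm ((max 0 h)\<^sup>2 / h) \<le> \<bar>h::real\<bar>" by simp
      show "((\<lambda>h. \<bar>h::real\<bar>) \<longlongrightarrow> 0) (at 0)" by (intro tendsto_eq_intros) auto
    qed
    then show ?thesis using 3 by (simp add: has_field_derivative_iff)
  qed
qed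

lemma norm_derivative:
  fixes x :: "'a::euclidean_space"
  assumes "x \<noteq> 0"
  shows "(norm has_derivative (\<lambda>h. (x \<bullet> h) / norm x)) (at x)"
  using has_derivative_norm[OF assms] by (simp add: sgn_div_norm inner_commute divide_inverse_commute)

lemma radial_derivative:
  fixes x :: "'a::euclidean_space"
  assumes "x \<noteq> 0" "(f has_real_derivative d) (at (norm x))"
  shows "((\<lambda>x. f (norm x)) has_derivative (\<lambda>h. d * (x \<bullet> h) / norm x)) (at x)"
  using has_derivative_compose[OF norm_derivative[OF assms(1)] assms(2)[unfolded has_field_derivative_def]]
  by simp

text \<open>
  Only the first two derivatives of a test function enter: they are continuous, so they are bounded, and
  they vanish outside a ball that contains the support.
\<close>
lemma test_function_data:
  fixes \<phi> :: "'a::euclidean_space \<Rightarrow> real"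
  assumes test: "test_function \<phi>"
    and P: "\<And>b x. P b x = frechet_derivative \<phi> (at x) b"
    and H: "\<And>b x. H b x = frechet_derivative (P b) (at x) b"
  obtains R A where "R > 0" "A \<ge> 0"
    "\<And>x. (\<phi> has_derivative (\<lambda>h. P h x)) (at x)"
    "\<And>b x. (P b has_derivative frechet_derivative (P b) (at x)) (at x)"
    "\<And>b. continuous_on UNIV (H b)"
    "\<And>x. norm x > R \<Longrightarrow> \<phi> x = 0" "\<And>b x. norm x > R \<Longrightarrow> P b x = 0"
    "\<And>b x. norm x > R \<Longrightarrow> H b x = 0"
    "\<And>x. \<bar>\<phi> x\<bar> \<le> A" "\<And>b x. b \<in> Basis \<Longrightarrow> \<bar>P b x\<bar> \<le> A"
    "\<And>b x. b \<in> Basis \<Longrightarrow> \<bar>H b x\<bar> \<le> A"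
proof -
  have C2: "Ck_on (Suc (Suc 0)) \<phi> UNIV" using test unfolding test_function_def by blast
  have P_fun: "P b = (\<lambda>x. frechet_derivative \<phi> (at x) b)"
    and H_fun: "H b = (\<lambda>x. frechet_derivative (P b) (at x) b)" for b
    by (auto simp: P H)
  have d\<phi>: "(\<phi> has_derivative (\<lambda>h. P h x)) (at x)" for x
    using C2 by (simp add: frechet_derivative_works P)
  have dP: "(P b has_derivative frechet_derivative (P b) (at x)) (at x)" for b x
    using C2 by (simp add: frechet_derivative_works P_fun)
  have cH: "continuous_on UNIV (H b)" for b
    using C2 by (simp add: H_fun P_fun)
  have cP: "continuous_on UNIV (P b)" for b
    by (rule has_derivative_continuous_on[OF has_derivative_at_withinI[OF dP]])
  have c\<phi>: "continuous_on UNIV \<phi>"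
    by (rule has_derivative_continuous_on[OF has_derivative_at_withinI[OF d\<phi>]])
  have "bounded (closure {x. \<phi> x \<noteq> 0})"
    using test by (simp add: test_function_def compact_imp_bounded)
  then obtain R where R: "R > 0" "\<And>x. x \<in> closure {x. \<phi> x \<noteq> 0} \<Longrightarrow> norm x \<le> R"
    by (auto simp: bounded_pos)
  have z\<phi>: "\<phi> x = 0" if "norm x > R" for x
    using R(2)[of x] closure_subset[of "{x. \<phi> x \<noteq> 0}"] that by force
  have flat: "frechet_derivative f (at x) b = 0"
    if "norm x > R" "\<And>y. norm y > R \<Longrightarrow> f y = 0" for f :: "'a \<Rightarrow> real" and b x
  proof -
    have "open {y::'a. R < norm y}" by (intro open_Collect_less continuous_intros)
    then have "(f has_derivative (\<lambda>h. 0)) (at x)"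
      by (intro has_derivative_transform_within_open[OF has_derivative_const[of 0]])
         (use that in auto)
    from frechet_derivative_at[OF this] show ?thesis by metis
  qed
  have zP: "P b x = 0" if "norm x > R" for b x
    unfolding P using that z\<phi> by (rule flat)
  have zH: "H b x = 0" if "norm x > R" for b x
    unfolding H using that zP by (rule flat)
  have bd: "\<exists>A\<ge>0. \<forall>x. \<bar>f x\<bar> \<le> A"
    if "continuous_on UNIV f" "\<And>x. norm x > R \<Longrightarrow> f x = 0" for f :: "'a \<Rightarrow> real"
  proof -
    have "bounded (f ` cball 0 R)"
      by (intro compact_imp_bounded compact_continuous_image continuous_on_subset[OF that(1)]) auto
    then obtain A where "A > 0" "\<And>x. norm x \<le> R \<Longrightarrow> \<bar>f x\<bar> \<le> A"
      by (auto simp: bounded_pos)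
    then show ?thesis using that(2) by (intro exI[of _ A]) (metis abs_zero less_imp_le not_le)
  qed
  obtain A0 where A0: "A0 \<ge> 0" "\<And>x. \<bar>\<phi> x\<bar> \<le> A0" using bd[OF c\<phi> z\<phi>] by blast
  obtain A1 where A1: "\<And>b. A1 b \<ge> 0" "\<And>b x. \<bar>P b x\<bar> \<le> A1 b" using bd[OF cP zP] by metis
  obtain A2 where A2: "\<And>b. A2 b \<ge> 0" "\<And>b x. \<bar>H b x\<bar> \<le> A2 b" using bd[OF cH zH] by metis
  define A where "A = A0 + sum A1 Basis + sum A2 Basis"
  have S: "A1 b \<le> sum A1 Basis" "A2 b \<le> sum A2 Basis" if "b \<in> Basis" for b :: 'a
    using that A1 A2 by (auto intro: member_le_sum)
  have S0: "0 \<le> sum A1 Basis" "0 \<le> sum A2 Basis" using A1 A2 by (auto intro: sum_nonneg)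
  have 1: "\<bar>\<phi> x\<bar> \<le> A" for x using A0(2)[of x] S0 by (simp add: A_def)
  have 2: "\<bar>P b x\<bar> \<le> A" if "b \<in> Basis" for b x
    using A1(2)[where b = b and x = x] S[OF that] S0 A0(1) by (simp add: A_def)
  have 3: "\<bar>H b x\<bar> \<le> A" if "b \<in> Basis" for b x
    using A2(2)[where b = b and x = x] S[OF that] S0 A0(1) by (simp add: A_def)
  have A_nonneg: "A \<ge> 0" using S0 A0(1) by (simp add: A_def)
  show thesis
    by (rule that[OF R(1) A_nonneg d\<phi> dP cH z\<phi> zP zH 1 2 3])
qed

text \<open>
  A radial function that is \<open>C\<^sup>2\<close> away from the origin has no hidden mass of its Laplacian at the
  origin if it and its derivatives do not blow up too fast. In terms of
  \<open>k(r) = u'(r) / r\<close>, the gradient is \<open>k(|x|) x\<close>, and the Laplacian is \<open>|x| k'(|x|) + N k(|x|)\<close>. The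
  function \<open>k\<close> is used instead of \<open>u'\<close> because it makes the gradient a product without
  division. The blow-up rates of \<open>u\<close>, \<open>u'\<close> and \<open>u''\<close> allowed are \<open>r\<^sup>2\<^sup>-\<^sup>\<gamma>\<close>, \<open>r\<^sup>1\<^sup>-\<^sup>\<gamma>\<close> and \<open>r\<^sup>-\<^sup>\<gamma>\<close>
  with \<open>\<gamma> < N\<close>, so that all terms of \<open>U \<Delta>\<phi> - \<phi> \<Delta>U\<close> are locally integrable.
  
  The values \<open>u 0 = k 0 = 0\<close> are a normalisation that, together with \<open>x / 0 = 0\<close>,
  lets all formulas below hold at the origin as well.
\<close>
theorem radial_distributional_solution:
  fixes U :: "'a::euclidean_space \<Rightarrow> real" and u k k' :: "real \<Rightarrow> real" and \<gamma> :: real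
  assumes \<gamma>: "0 \<le> \<gamma>" "\<gamma> < DIM('a)"
    and U: "\<And>x. U x = u (norm x)"
    and f: "\<And>x. f x = - (norm x * k' (norm x) + DIM('a) * k (norm x))"
    and du: "\<And>r. r > 0 \<Longrightarrow> (u has_real_derivative r * k r) (at r)"
    and dk: "\<And>r. r > 0 \<Longrightarrow> (k has_real_derivative k' r) (at r)"
    and at_0: "u 0 = 0" "k 0 = 0"
    and meas: "U \<in> borel_measurable borel" "f \<in> borel_measurable borel"
    and bound: "\<And>R. \<exists>C. \<forall>r. 0 < r \<longrightarrow> r \<le> R \<longrightarrow>
       \<bar>u r\<bar> \<le> C * r powr - \<gamma> * r\<^sup>2 \<and> \<bar>k r\<bar> \<le> C * r powr - \<gamma> \<and> \<bar>r * k' r\<bar> \<le> C * r powr - \<gamma>"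
  shows "distributional_neg_laplacian_eq U f"
proof -
  have U_bound: "\<exists>C. \<forall>x. norm x \<le> R \<longrightarrow> \<bar>U x\<bar> powr 1 \<le> C * norm x powr - \<gamma>" for R
  proof -
    obtain C where C: "\<And>r. 0 < r \<Longrightarrow> r \<le> R \<Longrightarrow> \<bar>u r\<bar> \<le> C * r powr - \<gamma> * r\<^sup>2" using bound by blast
    have "\<bar>U x\<bar> \<le> \<bar>C\<bar> * R\<^sup>2 * norm x powr - \<gamma>" if "norm x \<le> R" for x
    proof (cases "x = 0")
      case False
      have "\<bar>U x\<bar> \<le> C * norm x powr - \<gamma> * (norm x)\<^sup>2" using C[of "norm x"] False that by (simp add: U)
      also have "\<dots> \<le> \<bar>C\<bar> * norm x powr - \<gamma> * R\<^sup>2"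
        using that by (intro mult_mono power_mono) auto
      finally show ?thesis by (simp add: mult_ac)
    qed (simp add: U at_0)
    then show ?thesis by (intro exI[of _ "\<bar>C\<bar> * R\<^sup>2"]) simp
  qed
  have f_bound: "\<exists>C. \<forall>x. norm x \<le> R \<longrightarrow> \<bar>f x\<bar> powr 1 \<le> C * norm x powr - \<gamma>" for R
  proof -
    obtain C where C: "\<And>r. 0 < r \<Longrightarrow> r \<le> R \<Longrightarrow> \<bar>k r\<bar> \<le> C * r powr - \<gamma> \<and> \<bar>r * k' r\<bar> \<le> C * r powr - \<gamma>"
      using bound by blast
    have "\<bar>f x\<bar> \<le> (C + DIM('a) * C) * norm x powr - \<gamma>" if "norm x \<le> R" for x
    proof (cases "x = 0")
      case False
      have "\<bar>f x\<bar> \<le> \<bar>norm x * k' (norm x)\<bar> + DIM('a) * \<bar>k (norm x)\<bar>"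
        unfolding f abs_minus_cancel by (rule order_trans[OF abs_triangle_ineq]) (simp add: abs_mult)
      also have "\<dots> \<le> C * norm x powr - \<gamma> + DIM('a) * (C * norm x powr - \<gamma>)"
        using C[of "norm x"] False that by (intro add_mono mult_left_mono) auto
      finally show ?thesis by (simp add: algebra_simps)
    qed (simp add: f at_0)
    then show ?thesis by (intro exI[of _ "C + DIM('a) * C"]) simp
  qed
  have "- (LINT x|lebesgue. U x * laplacian \<phi> x) = (LINT x|lebesgue. f x * \<phi> x)"
    if test: "test_function \<phi>" for \<phi>
  proof -
    define P where "P b x = frechet_derivative \<phi> (at x) b" for b x
    define H where "H b x = frechet_derivative (P b) (at x) b" for b x
    obtain R A where R: "R > 0" and A: "A \<ge> 0"
      and d\<phi>: "\<And>x. (\<phi> has_derivative (\<lambda>h. P h x)) (at x)"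
      and dP: "\<And>b x. (P b has_derivative frechet_derivative (P b) (at x)) (at x)"
      and cH: "\<And>b. continuous_on UNIV (H b)"
      and z: "\<And>x. norm x > R \<Longrightarrow> \<phi> x = 0" "\<And>b x. norm x > R \<Longrightarrow> P b x = 0"
        "\<And>b x. norm x > R \<Longrightarrow> H b x = 0"
      and bd: "\<And>x. \<bar>\<phi> x\<bar> \<le> A" "\<And>b x. b \<in> Basis \<Longrightarrow> \<bar>P b x\<bar> \<le> A"
        "\<And>b x. b \<in> Basis \<Longrightarrow> \<bar>H b x\<bar> \<le> A"
      by (rule test_function_data[OF test P_def H_def], rule that)
    have [measurable]: "U \<in> borel_measurable borel" "f \<in> borel_measurable borel" by (fact meas)+
    have [measurable]: "\<phi> \<in> borel_measurable borel"
      by (intro borel_measurable_continuous_onI has_derivative_continuous_on[OF has_derivative_at_withinI[OF d\<phi>]])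
    have H_meas[measurable]: "H b \<in> borel_measurable borel" for b
      by (intro borel_measurable_continuous_onI cH)
    obtain C where C: "\<And>r. 0 < r \<Longrightarrow> r \<le> R \<Longrightarrow> \<bar>u r\<bar> \<le> C * r powr - \<gamma> * r\<^sup>2"
        "\<And>r. 0 < r \<Longrightarrow> r \<le> R \<Longrightarrow> \<bar>k r\<bar> \<le> C * r powr - \<gamma>"
        "\<And>r. 0 < r \<Longrightarrow> r \<le> R \<Longrightarrow> \<bar>r * k' r\<bar> \<le> C * r powr - \<gamma>"
      using bound[of R] by blast
    have C0: "C \<ge> 0"
      using C(2)[of R] R abs_ge_zero[of "k R"] by (smt (verit) mult_nonneg_nonneg mult_neg_pos powr_gt_zero)
    \<comment> \<open>The cutoff is \<open>m\<^sup>2\<close>: it vanishes for \<open>0 < |x|\<^sup>2 \<le> \<delta>\<close> and tends to \<open>1\<close> as \<open>\<delta> \<rightarrow> 0\<close>, and its gradient is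
       bounded by \<open>4 / |x|\<close> uniformly in \<open>\<delta>\<close>. \<open>W b\<close> is a component of \<open>U \<nabla>\<phi> - \<phi> \<nabla>U\<close>, \<open>L b\<close> is
       the derivative of \<open>W b\<close> in direction \<open>b\<close> (the products of first derivatives cancel), \<open>G\<close> is the component cut
       off, and \<open>D\<close> is the derivative of \<open>G\<close> in direction \<open>b\<close>.\<close>
    define m where "m \<delta> x = max 0 (1 - \<delta> / (norm x)\<^sup>2)" for \<delta> :: real and x :: 'a
    define W where "W b x = U x * P b x - \<phi> x * (k (norm x) * (x \<bullet> b))" for b x
    define L where "L b x = U x * H b x - \<phi> x * (k' (norm x) * (x \<bullet> b)\<^sup>2 / norm x + k (norm x))" for b x
    define G where "G \<delta> b x = (m \<delta> x)\<^sup>2 * W b x" for \<delta> b x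
    define D where "D \<delta> b x = 2 * m \<delta> x * (2 * \<delta> * (x \<bullet> b) / norm x ^ 4) * W b x + (m \<delta> x)\<^sup>2 * L b x" for \<delta> b x
    have m0: "m \<delta> x = 0" if "0 < norm x" "(norm x)\<^sup>2 \<le> \<delta>" for \<delta> x
      using that by (simp add: m_def max_def)
    have m01: "0 \<le> m \<delta> x" "m \<delta> x \<le> 1" if "\<delta> > 0" for \<delta> x
      using that by (auto simp: m_def)
    have W0: "W b 0 = 0" and L0: "L b 0 = 0" for b by (simp_all add: W_def L_def U at_0)
    have W_far: "W b x = 0" and L_far: "L b x = 0" if "norm x > R" for b x
      using z that by (simp_all add: W_def L_def)
    have G_der: "\<exists>G'. (G \<delta> b has_derivative G') (at x) \<and> G' b = D \<delta> b x"
      if \<delta>: "\<delta> > 0" and b: "b \<in> Basis" for \<delta> b x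
    proof (cases "x = 0")
      case True
      have "G \<delta> b y = 0" if "y \<in> ball 0 (sqrt \<delta>)" for y
      proof (cases "y = 0")
        case False
        have "norm y \<le> sqrt \<delta>" using that by simp
        then have "(norm y)\<^sup>2 \<le> (sqrt \<delta>)\<^sup>2" by (intro power_mono) auto
        then show ?thesis using m0[of y \<delta>] False \<delta> by (simp add: G_def)
      qed (simp add: G_def W0)
      then have "(G \<delta> b has_derivative (\<lambda>h. 0)) (at x)"
        by (intro has_derivative_transform_within_open[OF has_derivative_const[of 0], of "ball 0 (sqrt \<delta>)"])
           (use True \<delta> in auto)
      then show ?thesis using True by (intro exI[of _ "\<lambda>h. 0"]) (simp add: D_def W0 L0)
    next
      case False
      define r where "r = norm x"
      have r: "r > 0" using False by (simp add: r_def)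
      have dU: "(U has_derivative (\<lambda>h. k r * (x \<bullet> h))) (at x)"
        using radial_derivative[OF False du[of "norm x"]] r unfolding U[abs_def] r_def by (simp add: field_simps)
      have dkk: "((\<lambda>x. k (norm x)) has_derivative (\<lambda>h. k' r * (x \<bullet> h) / r)) (at x)"
        using radial_derivative[OF False dk[of "norm x"]] r unfolding r_def by simp
      have dW: "(W b has_derivative (\<lambda>h. (U x * frechet_derivative (P b) (at x) h + k r * (x \<bullet> h) * P b x)
          - (\<phi> x * (k r * (h \<bullet> b) + k' r * (x \<bullet> h) / r * (x \<bullet> b)) + P h x * (k r * (x \<bullet> b))))) (at x)"
        unfolding W_def[abs_def] r_def
        by (intro has_derivative_diff has_derivative_mult dU[unfolded r_def] dP d\<phi> dkk[unfolded r_def]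
            has_derivative_inner_left has_derivative_ident)
      have "((\<lambda>r. 1 - \<delta> / r\<^sup>2) has_real_derivative 2 * \<delta> / norm x ^ 3) (at (norm x))"
        using r by (auto intro!: derivative_eq_intros simp: r_def field_simps eval_nat_numeral)
      from radial_derivative[OF False DERIV_chain2[OF positive_part_square_derivative this]]
      have dm: "((\<lambda>x. (m \<delta> x)\<^sup>2) has_derivative (\<lambda>h. 2 * m \<delta> x * (2 * \<delta> / norm x ^ 3) * (x \<bullet> h) / norm x)) (at x)"
        by (simp add: m_def)
      have "(G \<delta> b has_derivative (\<lambda>h. (m \<delta> x)\<^sup>2 * ((U x * frechet_derivative (P b) (at x) h + k r * (x \<bullet> h) * P b x)
          - (\<phi> x * (k r * (h \<bullet> b) + k' r * (x \<bullet> h) / r * (x \<bullet> b)) + P h x * (k r * (x \<bullet> b))))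
          + 2 * m \<delta> x * (2 * \<delta> / norm x ^ 3) * (x \<bullet> h) / norm x * W b x)) (at x)"
        unfolding G_def[abs_def] by (intro has_derivative_mult dm dW)
      moreover have "norm x ^ 4 = norm x ^ 3 * norm x" by (simp add: eval_nat_numeral)
      then have "(m \<delta> x)\<^sup>2 * ((U x * frechet_derivative (P b) (at x) b + k r * (x \<bullet> b) * P b x)
          - (\<phi> x * (k r * (b \<bullet> b) + k' r * (x \<bullet> b) / r * (x \<bullet> b)) + P b x * (k r * (x \<bullet> b))))
          + 2 * m \<delta> x * (2 * \<delta> / norm x ^ 3) * (x \<bullet> b) / norm x * W b x = D \<delta> b x"
        using b by (simp add: D_def L_def H_def r_def algebra_simps power2_eq_square)
      ultimately show ?thesis by blast
    qed
    \<comment> \<open>The constant collects the bounds on the gradient of the cutoff times \<open>W\<close> (first term) and on \<open>L\<close>.\<close>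
    define K where "K = 4 * A * C * (R + 1) + A * C * R\<^sup>2 + 2 * A * C"
    have D_bound: "\<bar>D \<delta> b x\<bar> \<le> K * (norm x powr - \<gamma> * indicator (cball 0 R) x)"
      if \<delta>: "\<delta> > 0" and b: "b \<in> Basis" for \<delta> b x
    proof (cases "x = 0 \<or> norm x > R")
      case True
      then show ?thesis using W0 L0 W_far L_far by (auto simp: D_def)
    next
      case False
      define r where "r = norm x"
      define q where "q = r powr - \<gamma>"
      have r: "r > 0" "r \<le> R" using False by (auto simp: r_def)
      have q0: "q \<ge> 0" by (simp add: q_def)
      have xb: "\<bar>x \<bullet> b\<bar> \<le> r" using b by (simp add: r_def Basis_le_norm)
      have "\<bar>U x * P b x\<bar> \<le> (C * q * r\<^sup>2) * A"
        unfolding abs_mult using C(1)[of r] r bd(2)[OF b] by (intro mult_mono) (auto simp: U r_def q_def)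
      moreover have "\<bar>\<phi> x * (k r * (x \<bullet> b))\<bar> \<le> A * (C * q * r)"
        unfolding abs_mult using C(2)[of r] r bd(1)[of x] xb C0 q0 A by (intro mult_mono) (auto simp: q_def)
      ultimately have W: "\<bar>W b x\<bar> \<le> A * C * q * (r\<^sup>2 + r)"
        using abs_triangle_ineq4[of "U x * P b x" "\<phi> x * (k r * (x \<bullet> b))"]
        unfolding W_def r_def[symmetric] by (simp add: algebra_simps)
      have cut: "\<bar>2 * m \<delta> x * (2 * \<delta> * (x \<bullet> b) / norm x ^ 4)\<bar> \<le> 4 / r"
      proof (cases "r\<^sup>2 \<le> \<delta>")
        case True
        then show ?thesis using m0[of x \<delta>] r by (simp add: r_def)
      next
        case False
        have "\<bar>2 * m \<delta> x * (2 * \<delta> * (x \<bullet> b) / norm x ^ 4)\<bar> = 2 * m \<delta> x * (2 * \<delta> * \<bar>x \<bullet> b\<bar> / r ^ 4)"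
          using m01[OF \<delta>, of x] \<delta> by (simp add: abs_mult r_def)
        also have "\<dots> \<le> 2 * 1 * (2 * r\<^sup>2 * r / r ^ 4)"
          using m01[OF \<delta>, of x] \<delta> False xb r by (intro mult_mono divide_right_mono) auto
        also have "\<dots> = 4 / r" using r by (simp add: field_simps eval_nat_numeral)
        finally show ?thesis .
      qed
      have "\<bar>2 * m \<delta> x * (2 * \<delta> * (x \<bullet> b) / norm x ^ 4) * W b x\<bar> \<le> 4 / r * (A * C * q * (r\<^sup>2 + r))"
        unfolding abs_mult[of _ "W b x"] using cut W r by (intro mult_mono) auto
      also have "\<dots> = 4 * A * C * q * (r + 1)" using r by (simp add: field_simps power2_eq_square)
      finally have 1: "\<bar>2 * m \<delta> x * (2 * \<delta> * (x \<bullet> b) / norm x ^ 4) * W b x\<bar> \<le> 4 * A * C * q * (r + 1)" .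
      have "\<bar>U x * H b x\<bar> \<le> (C * q * r\<^sup>2) * A"
        unfolding abs_mult using C(1)[of r] r bd(3)[OF b] by (intro mult_mono) (auto simp: U r_def q_def)
      moreover have "\<bar>k' r * (x \<bullet> b)\<^sup>2 / r + k r\<bar> \<le> 2 * C * q"
      proof -
        have "(x \<bullet> b)\<^sup>2 \<le> r\<^sup>2" using xb by (simp add: abs_le_square_iff[symmetric])
        then have "\<bar>k' r\<bar> * (x \<bullet> b)\<^sup>2 / r \<le> \<bar>k' r\<bar> * r\<^sup>2 / r"
          using r by (intro divide_right_mono mult_left_mono) auto
        also have "\<dots> = \<bar>r * k' r\<bar>" using r by (simp add: power2_eq_square abs_mult)
        finally have "\<bar>k' r * (x \<bullet> b)\<^sup>2 / r\<bar> \<le> C * q" using C(3)[of r] r by (simp add: abs_mult q_def)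
        then show ?thesis using C(2)[of r] r abs_triangle_ineq[of "k' r * (x \<bullet> b)\<^sup>2 / r" "k r"] by (simp add: q_def)
      qed
      then have "\<bar>\<phi> x * (k' r * (x \<bullet> b)\<^sup>2 / r + k r)\<bar> \<le> A * (2 * C * q)"
        unfolding abs_mult[of "\<phi> x"] using bd(1)[of x] A by (intro mult_mono) auto
      ultimately have "\<bar>L b x\<bar> \<le> A * C * q * r\<^sup>2 + 2 * A * C * q"
        using abs_triangle_ineq4[of "U x * H b x" "\<phi> x * (k' r * (x \<bullet> b)\<^sup>2 / r + k r)"]
        unfolding L_def r_def[symmetric] by (simp add: algebra_simps)
      moreover have "\<bar>(m \<delta> x)\<^sup>2 * L b x\<bar> \<le> 1 * \<bar>L b x\<bar>"
        unfolding abs_mult using m01[OF \<delta>, of x] by (intro mult_right_mono) (auto simp: power_le_one)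
      ultimately have 2: "\<bar>(m \<delta> x)\<^sup>2 * L b x\<bar> \<le> A * C * q * r\<^sup>2 + 2 * A * C * q" by linarith
      have "\<bar>D \<delta> b x\<bar> \<le> 4 * A * C * q * (r + 1) + (A * C * q * r\<^sup>2 + 2 * A * C * q)"
        unfolding D_def using 1 2 by (rule order_trans[OF abs_triangle_ineq add_mono])
      also have "\<dots> \<le> 4 * A * C * q * (R + 1) + (A * C * q * R\<^sup>2 + 2 * A * C * q)"
        using r A C0 q0 by (intro add_mono mult_left_mono power_mono) auto
      also have "\<dots> = (4 * A * C * (R + 1) + A * C * R\<^sup>2 + 2 * A * C) * q" by (simp add: algebra_simps)
      finally show ?thesis using False by (simp add: q_def r_def K_def)
    qed
    have D_int: "integrable lborel (D \<delta> b) \<and> integral\<^sup>L lborel (D \<delta> b) = 0"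
      if \<delta>: "\<delta> > 0" and b: "b \<in> Basis" for \<delta> b
    proof -
      obtain G' where G': "\<And>x. (G \<delta> b has_derivative G' x) (at x)" "\<And>x. D \<delta> b x = G' x b"
        using G_der[OF \<delta> b] by metis
      \<comment> \<open>For fixed \<open>\<delta>\<close> the singularity is cut away, so \<open>D\<close> is bounded.\<close>
      have "\<bar>D \<delta> b x\<bar> \<le> \<bar>K\<bar> * sqrt \<delta> powr - \<gamma>" for x
      proof (cases "norm x < sqrt \<delta>")
        case True
        then have "(norm x)\<^sup>2 \<le> \<delta>" using \<delta> by (metis less_imp_le norm_ge_zero real_less_rsqrt real_sqrt_le_iff real_sqrt_abs abs_norm_cancel)
        then have "D \<delta> b x = 0"
          using m0[of x \<delta>] W0 L0 by (cases "x = 0") (auto simp: D_def)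
        then show ?thesis by simp
      next
        case False
        have "norm x powr - \<gamma> \<le> sqrt \<delta> powr - \<gamma>"
          using False \<gamma> \<delta> by (intro powr_mono2') auto
        then have "K * (norm x powr - \<gamma> * indicator (cball 0 R) x) \<le> \<bar>K\<bar> * sqrt \<delta> powr - \<gamma>"
          by (intro mult_mono) (auto simp: indicator_def)
        then show ?thesis using D_bound[OF \<delta> b, of x] by linarith
      qed
      from integral_directional_derivative_eq_0[where R = R, OF G' this] show ?thesis
        using W_far by (simp add: G_def)
    qed
    have w: "integrable lborel (\<lambda>x::'a. K * (norm x powr - \<gamma> * indicator (cball 0 R) x))"
      by (intro integrable_mult_right integrable_norm_powr_cball \<gamma> R)
    have L_int0: "integral\<^sup>L lborel (L b) = 0 \<and> integrable lborel (L b)" if b: "b \<in> Basis" for b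
    proof -
      define s where "s n = D (1 / real (Suc n)) b" for n
      have lim: "(\<lambda>n. s n x) \<longlonglongrightarrow> L b x" for x
      proof (cases "x = 0")
        case False
        have \<delta>: "(\<lambda>n. 1 / real (Suc n)) \<longlonglongrightarrow> 0" using lim_1_over_n[THEN LIMSEQ_Suc] .
        have "(\<lambda>n. m (1 / real (Suc n)) x) \<longlonglongrightarrow> max 0 (1 - 0 / (norm x)\<^sup>2)"
          unfolding m_def using False by (intro tendsto_intros \<delta>) auto
        then have m: "(\<lambda>n. m (1 / real (Suc n)) x) \<longlonglongrightarrow> 1" by simp
        have "(\<lambda>n. s n x) \<longlonglongrightarrow> 2 * 1 * (2 * 0 * (x \<bullet> b) / norm x ^ 4) * W b x + 1\<^sup>2 * L b x"
          unfolding s_def D_def using False by (intro tendsto_intros \<delta> m) auto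
        then show ?thesis by simp
      qed (simp add: s_def D_def W0 L0)
      have s: "integrable lborel (s n)" "integral\<^sup>L lborel (s n) = 0" for n
        using D_int[OF _ b, of "1 / real (Suc n)"] by (auto simp: s_def)
      have L_meas: "L b \<in> borel_measurable lborel"
        by (rule borel_measurable_LIMSEQ_real[OF lim]) (rule borel_measurable_integrable[OF s(1)])
      have dom: "norm (s n x) \<le> K * (norm x powr - \<gamma> * indicator (cball 0 R) x)" for n x
        using D_bound[OF _ b, of "1 / real (Suc n)" x] by (simp add: s_def)
      have s_meas: "s n \<in> borel_measurable lborel" for n by (rule borel_measurable_integrable[OF s(1)])
      have "(\<lambda>n. integral\<^sup>L lborel (s n)) \<longlonglongrightarrow> integral\<^sup>L lborel (L b)"
        by (rule integral_dominated_convergence[OF L_meas s_meas w AE_I2 AE_I2]) (rule lim dom)+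
      moreover have "integrable lborel (L b)"
        by (rule integrable_dominated_convergence[OF L_meas s_meas w AE_I2 AE_I2]) (rule lim dom)+
      ultimately show ?thesis unfolding s(2) using LIMSEQ_unique[OF _ tendsto_const] by blast
    qed
    have lap: "laplacian \<phi> x = (\<Sum>b\<in>Basis. H b x)" for x
      by (simp add: laplacian_def H_def P_def[abs_def])
    have sum_L: "(\<Sum>b\<in>Basis. L b x) = U x * laplacian \<phi> x + f x * \<phi> x" for x
    proof -
      have "(\<Sum>b\<in>Basis. (x \<bullet> b)\<^sup>2) = (norm x)\<^sup>2"
        unfolding power2_norm_eq_inner euclidean_inner[of x x] by (simp add: power2_eq_square)
      then have "(\<Sum>b\<in>Basis. k' (norm x) * (x \<bullet> b)\<^sup>2 / norm x + k (norm x)) = - f x"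
        by (simp add: f sum.distrib flip: sum_divide_distrib sum_distrib_left)
           (simp add: power2_eq_square)
      then show ?thesis
        by (simp add: L_def sum_subtractf lap flip: sum_distrib_left)
    qed
    have "(LINT x|lborel. U x * laplacian \<phi> x + f x * \<phi> x) = 0"
      unfolding sum_L[symmetric] using L_int0 by (subst Bochner_Integration.integral_sum) auto
    moreover have lap_meas[measurable]: "laplacian \<phi> \<in> borel_measurable borel"
      unfolding lap[abs_def] by measurable
    have int_prod: "integrable lborel (\<lambda>x. g x * \<psi> x)"
      if g: "g \<in> borel_measurable borel" "\<exists>C. \<forall>x. norm x \<le> R \<longrightarrow> \<bar>g x\<bar> powr 1 \<le> C * norm x powr - \<gamma>"
        and \<psi>: "\<psi> \<in> borel_measurable borel" "\<And>x. \<bar>\<psi> x\<bar> \<le> B" "\<And>x. norm x > R \<Longrightarrow> \<psi> x = 0"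
      for g \<psi> :: "'a \<Rightarrow> real" and B
    proof -
      obtain C' where C': "\<And>x. norm x \<le> R \<Longrightarrow> \<bar>g x\<bar> \<le> C' * norm x powr - \<gamma>" using g(2) by auto
      have "\<bar>g x * \<psi> x\<bar> \<le> (C' * B) * (norm x powr - \<gamma> * indicator (cball 0 R) x)" for x
      proof (cases "norm x \<le> R")
        case True
        have "\<bar>g x * \<psi> x\<bar> \<le> (C' * norm x powr - \<gamma>) * B"
          unfolding abs_mult using C'[OF True] \<psi>(2)[of x] by (intro mult_mono) auto
        then show ?thesis using True by (simp add: mult_ac)
      qed (use \<psi>(3) in simp)
      moreover have "(\<lambda>x. g x * \<psi> x) \<in> borel_measurable borel"
        using g(1) \<psi>(1) by measurable
      ultimately show ?thesis using integrable_of_norm_powr_bound[OF \<gamma>] by blast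
    qed
    have "integrable lborel (\<lambda>x. U x * laplacian \<phi> x)"
    proof (rule int_prod[OF meas(1) U_bound lap_meas])
      show "\<bar>laplacian \<phi> x\<bar> \<le> DIM('a) * A" for x
        unfolding lap using sum_bounded_above[of Basis "\<lambda>b. \<bar>H b x\<bar>" A] bd(3)
        by (intro order_trans[OF sum_abs]) auto
      show "laplacian \<phi> x = 0" if "norm x > R" for x
        unfolding lap using z(3)[OF that] by simp
    qed
    moreover have "integrable lborel (\<lambda>x. f x * \<phi> x)"
      by (rule int_prod[OF meas(2) f_bound _ bd(1) z(1)]) measurable
    ultimately have "(LINT x|lborel. U x * laplacian \<phi> x) + (LINT x|lborel. f x * \<phi> x) = 0"
      by simp
    moreover have "(\<lambda>x. U x * laplacian \<phi> x) \<in> borel_measurable lborel"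
      "(\<lambda>x. f x * \<phi> x) \<in> borel_measurable lborel" by measurable
    ultimately show ?thesis by (simp add: integral_completion)
  qed
  moreover have "Lp_loc 1 U" by (rule Lp_loc_of_norm_powr_bound[OF \<gamma> meas(1) U_bound])
  moreover have "Lp_loc 1 f" by (rule Lp_loc_of_norm_powr_bound[OF \<gamma> meas(2) f_bound])
  ultimately show ?thesis unfolding distributional_neg_laplacian_eq_def by blast
qed

lemma Ck_on_cong_open:
  assumes "open S" "\<And>x. x \<in> S \<Longrightarrow> f x = g x"
  shows "Ck_on n f S \<longleftrightarrow> Ck_on n g S"
  using assms(2)
proof (induction n arbitrary: f g)
  case 0
  then show ?case by (simp cong: continuous_on_cong)
next
  case (Suc n)
  have "(f has_derivative f') (at x) \<longleftrightarrow> (g has_derivative f') (at x)" if "x \<in> S" for f' x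
    using has_derivative_transform_within_open[OF _ assms(1) that] Suc.prems by metis
  then have "f differentiable (at x) \<longleftrightarrow> g differentiable (at x)"
    and "frechet_derivative f (at x) = frechet_derivative g (at x)" if "x \<in> S" for x
    using that by (simp_all add: differentiable_def frechet_derivative_def)
  then show ?case
    using Suc.IH[of "\<lambda>x. frechet_derivative f (at x) v" "\<lambda>x. frechet_derivative g (at x) v" for v]
    by (simp only: Ck_on.simps) blast
qed

text \<open>
  The first derivative in direction \<open>v\<close> is \<open>k(|x|) (x \<bullet> v)\<close>, and it can be differentiated once more with
  continuous result.
\<close>
lemma radial_Ck_on_2:
  fixes U :: "'a::euclidean_space \<Rightarrow> real"
  assumes U: "\<And>x. U x = u (norm x)"
    and du: "\<And>r. r > 0 \<Longrightarrow> (u has_real_derivative r * k r) (at r)"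
    and dk: "\<And>r. r > 0 \<Longrightarrow> (k has_real_derivative k' r) (at r)"
    and ck': "continuous_on {0<..} k'"
  shows "Ck_on 2 U (- {0})"
proof -
  have op: "open (- {0::'a})" by (rule open_Compl) simp
  have dU: "(U has_derivative (\<lambda>h. k (norm x) * (x \<bullet> h))) (at x)" if "x \<noteq> 0" for x
    using radial_derivative[OF that du[of "norm x"]] that unfolding U[abs_def] by simp
  have dV: "((\<lambda>x. k (norm x) * (x \<bullet> v)) has_derivative
      (\<lambda>h. k (norm x) * (h \<bullet> v) + k' (norm x) * (x \<bullet> h) / norm x * (x \<bullet> v))) (at x)"
    if "x \<noteq> 0" for x v :: 'a
    using that by (intro has_derivative_mult radial_derivative dk has_derivative_inner_left has_derivative_ident) auto
  have ck: "continuous_on {0<..} k"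
    by (rule DERIV_continuous_on[OF has_field_derivative_at_within[OF dk]]) simp
  have V: "Ck_on (Suc 0) (\<lambda>x. k (norm x) * (x \<bullet> v)) (- {0::'a})" for v :: 'a
  proof -
    have "Ck_on 0 (\<lambda>x. frechet_derivative (\<lambda>x. k (norm x) * (x \<bullet> v)) (at x) h) (- {0})" for h :: 'a
    proof -
      have "continuous_on (- {0})
          (\<lambda>x. k (norm x) * (h \<bullet> v) + k' (norm x) * (x \<bullet> h) / norm x * (x \<bullet> v))"
        by (intro continuous_intros continuous_on_compose2[OF ck] continuous_on_compose2[OF ck']) auto
      moreover have "k (norm x) * (h \<bullet> v) + k' (norm x) * (x \<bullet> h) / norm x * (x \<bullet> v)
          = frechet_derivative (\<lambda>x. k (norm x) * (x \<bullet> v)) (at x) h" if "x \<in> - {0}" for x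
        using fun_cong[OF frechet_derivative_at[OF dV[of x v]], of h] that by simp
      ultimately show ?thesis
        unfolding Ck_on.simps by (rule continuous_on_eq)
    qed
    moreover have "(\<lambda>x. k (norm x) * (x \<bullet> v)) differentiable (at x)" if "x \<noteq> 0" for x
      using dV[OF that] by (rule differentiableI)
    ultimately show ?thesis by simp
  qed
  have "Ck_on (Suc 0) (\<lambda>x. frechet_derivative U (at x) v) (- {0})" for v
  proof -
    have "k (norm x) * (x \<bullet> v) = frechet_derivative U (at x) v" if "x \<in> - {0}" for x
      using fun_cong[OF frechet_derivative_at[OF dU[of x]], of v] that by simp
    then have "Ck_on (Suc 0) (\<lambda>x. k (norm x) * (x \<bullet> v)) (- {0}) =
        Ck_on (Suc 0) (\<lambda>x. frechet_derivative U (at x) v) (- {0})"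
      by (rule Ck_on_cong_open[OF op])
    then show ?thesis using V by (rule iffD1)
  qed
  moreover have "U differentiable (at x)" if "x \<noteq> 0" for x
    using dU[OF that] by (rule differentiableI)
  ultimately show ?thesis by (simp add: numeral_2_eq_2)
qed

section \<open>From the oscillator to the radial profile\<close>

text \<open>
  The dimension enters the radial equation only as the real number \<open>N\<close>. The interpretation as an
  oscillator has \<open>\<beta> = p (N - 2 - p)\<close> and \<open>c = 2 p - (N - 2)\<close>.
\<close>
locale radial_emden_fowler =
  fixes N \<alpha> p :: real
  assumes N: "N \<ge> 3" and \<alpha>_lower: "2 / (N - 2) < \<alpha>" and \<alpha>_upper: "\<alpha> < 4 / (N - 2)"
    and p: "p = 2 / \<alpha>"
begin

lemma exponents: "\<alpha> > 0" "p > 0" "p < N - 2" "N - 2 < 2 * p" "p * \<alpha> = 2"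
proof -
  have "2 / (N - 2) > 0" using N by simp
  with \<alpha>_lower show \<alpha>: "\<alpha> > 0" by linarith
  show "p > 0" "p * \<alpha> = 2" using \<alpha> by (simp_all add: p)
  show "p < N - 2" "N - 2 < 2 * p"
    using \<alpha>_lower \<alpha>_upper N \<alpha> by (simp_all add: p field_simps)
qed

sublocale emden_fowler \<alpha> "p * (N - 2 - p)" "2 * p - (N - 2)"
  using exponents by unfold_locales auto

definition profile :: "(real \<Rightarrow> real) \<Rightarrow> real \<Rightarrow> real \<Rightarrow> real" where
  "profile w \<tau> r = r powr - p * w (ln r - \<tau>)"

text \<open>
  For the profile \<open>u\<close>, this is \<open>u'(r) / r\<close>.
\<close>
definition slope :: "(real \<Rightarrow> real) \<Rightarrow> (real \<Rightarrow> real) \<Rightarrow> real \<Rightarrow> real \<Rightarrow> real" where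
  "slope w v \<tau> r = r powr (- p - 2) * (v (ln r - \<tau>) - p * w (ln r - \<tau>))"

text \<open>
  The derivative of \<open>slope\<close>, with \<open>v'\<close> expressed through the equation.
\<close>
definition slope' :: "(real \<Rightarrow> real) \<Rightarrow> (real \<Rightarrow> real) \<Rightarrow> real \<Rightarrow> real \<Rightarrow> real" where
  "slope' w v \<tau> r = r powr (- p - 3) *
     ((2 * p - (N - 2)) * v (ln r - \<tau>) + force (w (ln r - \<tau>)) - p * v (ln r - \<tau>)
      - (p + 2) * (v (ln r - \<tau>) - p * w (ln r - \<tau>)))"

context
  fixes a \<tau> :: real and w v :: "real \<Rightarrow> real"
  assumes orbit: "zero_energy_orbit a w v"
begin

lemma shifted_derivatives:
  assumes "r > 0"
  shows "((\<lambda>r. w (ln r - \<tau>)) has_real_derivative v (ln r - \<tau>) / r) (at r)"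
    and "((\<lambda>r. v (ln r - \<tau>)) has_real_derivative
      ((2 * p - (N - 2)) * v (ln r - \<tau>) + force (w (ln r - \<tau>))) / r) (at r)"
proof -
  have l: "((\<lambda>r. ln r - \<tau>) has_real_derivative 1 / r) (at r)"
    using assms by (auto intro!: derivative_eq_intros)
  have dw: "(w has_real_derivative v s) (at s)"
    and dv: "(v has_real_derivative (2 * p - (N - 2)) * v s + force (w s)) (at s)" for s
    using orbit by (auto simp: zero_energy_orbit_def solves_at_def)
  show "((\<lambda>r. w (ln r - \<tau>)) has_real_derivative v (ln r - \<tau>) / r) (at r)"
    using DERIV_chain2[OF dw l] by simp
  show "((\<lambda>r. v (ln r - \<tau>)) has_real_derivative
      ((2 * p - (N - 2)) * v (ln r - \<tau>) + force (w (ln r - \<tau>))) / r) (at r)"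
    using DERIV_chain2[OF dv l] by simp
qed

lemma profile_derivative:
  assumes r: "r > 0"
  shows "(profile w \<tau> has_real_derivative r * slope w v \<tau> r) (at r)"
proof -
  have "(profile w \<tau> has_real_derivative
      r powr - p * (v (ln r - \<tau>) / r) + - p * r powr (- p - 1) * w (ln r - \<tau>)) (at r)"
    unfolding profile_def[abs_def]
    by (intro DERIV_mult' shifted_derivatives[OF r] has_real_derivative_powr r)
  also have "r powr - p * (v (ln r - \<tau>) / r) + - p * r powr (- p - 1) * w (ln r - \<tau>)
      = r * slope w v \<tau> r"
    using r by (simp add: slope_def powr_diff field_simps power2_eq_square)
  finally show ?thesis .
qed

lemma slope_derivative:
  assumes r: "r > 0"
  shows "(slope w v \<tau> has_real_derivative slope' w v \<tau> r) (at r)"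
proof -
  define W where "W = w (ln r - \<tau>)"
  define V where "V = v (ln r - \<tau>)"
  define Z where "Z = (2 * p - (N - 2)) * V + force W"
  have "(slope w v \<tau> has_real_derivative
      r powr (- p - 2) * (Z / r - p * (V / r)) + (- p - 2) * r powr (- p - 2 - 1) * (V - p * W)) (at r)"
    unfolding slope_def[abs_def] Z_def V_def W_def
    by (intro DERIV_mult' DERIV_diff DERIV_cmult shifted_derivatives[OF r] has_real_derivative_powr r)
  also have "r powr (- p - 2) = r powr (- p - 3) * r"
    using r by (simp add: powr_diff field_simps eval_nat_numeral)
  also have "r powr (- p - 3) * r * (Z / r - p * (V / r)) + (- p - 2) * r powr (- p - 2 - 1) * (V - p * W)
      = slope' w v \<tau> r"
    using r unfolding slope'_def V_def[symmetric] W_def[symmetric] Z_def[symmetric]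
    by (simp add: algebra_simps)
  finally show ?thesis .
qed

text \<open>
  The change of variables: multiplying by \<open>r\<^sup>p\<^sup>+\<^sup>2\<close> turns the radial equation into the equation of the oscillator.
  The powers of \<open>r\<close> match because \<open>p \<alpha> = 2\<close>.
\<close>
lemma profile_equation:
  assumes r: "r > 0"
  shows "\<bar>profile w \<tau> r\<bar> powr \<alpha> * profile w \<tau> r
     = - (r * slope' w v \<tau> r + N * slope w v \<tau> r)"
proof -
  define W where "W = w (ln r - \<tau>)"
  define V where "V = v (ln r - \<tau>)"
  have r3: "r * r powr (- p - 3) = r powr (- p - 2)"
    using r by (simp add: powr_diff field_simps eval_nat_numeral)
  have "\<bar>profile w \<tau> r\<bar> powr \<alpha> * profile w \<tau> r
      = (r powr - p) powr \<alpha> * r powr - p * (\<bar>W\<bar> powr \<alpha> * W)"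
    by (simp add: profile_def W_def abs_mult powr_mult)
  also have "(r powr - p) powr \<alpha> * r powr - p = r powr (- p - 2)"
    using exponents(5) unfolding powr_powr powr_add[symmetric] by (simp add: algebra_simps)
  finally have lhs: "\<bar>profile w \<tau> r\<bar> powr \<alpha> * profile w \<tau> r = r powr (- p - 2) * (\<bar>W\<bar> powr \<alpha> * W)" .
  have "r * slope' w v \<tau> r + N * slope w v \<tau> r
      = (r * r powr (- p - 3)) * ((2 * p - (N - 2)) * V + force W - p * V - (p + 2) * (V - p * W))
        + r powr (- p - 2) * (N * (V - p * W))"
    by (simp add: slope_def slope'_def V_def W_def)
  also have "\<dots> = r powr (- p - 2) * (- (\<bar>W\<bar> powr \<alpha> * W))"
    unfolding r3 force_def by (simp add: algebra_simps)
  finally show ?thesis using lhs by simp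
qed

text \<open>
  Up to radius \<open>R\<close> both \<open>w\<close> and \<open>v\<close> are bounded by the envelope at time \<open>ln R - \<tau>\<close>, since the envelope
  increases. So the profile and its derivatives have the blow-up rates of \<open>r\<^sup>-\<^sup>p\<close>.
\<close>
lemma profile_bounds:
  "\<exists>C. \<forall>r. 0 < r \<longrightarrow> r \<le> R \<longrightarrow>
     \<bar>profile w \<tau> r\<bar> \<le> C * r powr - (p + 2) * r\<^sup>2 \<and> \<bar>slope w v \<tau> r\<bar> \<le> C * r powr - (p + 2)
     \<and> \<bar>r * slope' w v \<tau> r\<bar> \<le> C * r powr - (p + 2)"
proof -
  define B where "B = envelope (ln R - \<tau>)"
  define M where "M = (p * (N - 2 - p) + (\<alpha> + 1) * B powr \<alpha>) * B"
  define C where "C = B + (1 + p) * B + ((2 * p - (N - 2)) * B + M + p * B + (p + 2) * ((1 + p) * B))"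
  have c: "2 * p - (N - 2) > 0" using exponents by simp
  have B0: "B > 0" unfolding B_def by (rule envelope_pos)
  have M0: "M \<ge> 0" using B0 exponents by (simp add: M_def)
  have C: "B \<le> C" "(1 + p) * B \<le> C" "(2 * p - (N - 2)) * B + M + p * B + (p + 2) * ((1 + p) * B) \<le> C"
    using B0 M0 c exponents by (simp_all add: C_def)
  have "\<bar>profile w \<tau> r\<bar> \<le> C * r powr - (p + 2) * r\<^sup>2 \<and> \<bar>slope w v \<tau> r\<bar> \<le> C * r powr - (p + 2)
     \<and> \<bar>r * slope' w v \<tau> r\<bar> \<le> C * r powr - (p + 2)" if r: "0 < r" "r \<le> R" for r
  proof -
    define W where "W = w (ln r - \<tau>)"
    define V where "V = v (ln r - \<tau>)"
    define q where "q = r powr - (p + 2)"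
    have q: "q \<ge> 0" by (simp add: q_def)
    have "envelope (ln r - \<tau>) \<le> B"
      unfolding B_def envelope_def using r c coercivity_pos by (intro mult_left_mono) auto
    then have W: "\<bar>W\<bar> \<le> B" and V: "\<bar>V\<bar> \<le> B"
      using zero_energy_orbit_bound[OF orbit, of "ln r - \<tau>"] by (auto simp: W_def V_def)
    have qr2: "r powr - p = q * r\<^sup>2" "r powr (- p - 2) = q" "r * r powr (- p - 3) = q"
      unfolding q_def using r by (simp_all add: powr_minus powr_add powr_diff field_simps eval_nat_numeral)
    have "\<bar>p * W\<bar> \<le> p * B" using W exponents by (simp add: abs_mult)
    then have VW: "\<bar>V - p * W\<bar> \<le> (1 + p) * B"
      using V abs_triangle_ineq4[of V "p * W"] by (simp add: algebra_simps)
    have F: "\<bar>force W\<bar> \<le> M"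
      using force_lipschitz[of W B 0] W B0 exponents order_trans[OF _ mult_left_mono[OF W]]
      by (auto simp: M_def force_def[of 0])
    have 1: "\<bar>profile w \<tau> r\<bar> \<le> C * q * r\<^sup>2"
    proof -
      have "\<bar>profile w \<tau> r\<bar> = (q * r\<^sup>2) * \<bar>W\<bar>"
        using q by (simp add: profile_def W_def abs_mult qr2)
      also have "\<dots> \<le> (q * r\<^sup>2) * C" using W C q by (intro mult_left_mono) auto
      finally show ?thesis by (simp add: mult_ac)
    qed
    have 2: "\<bar>slope w v \<tau> r\<bar> \<le> C * q"
    proof -
      have "\<bar>slope w v \<tau> r\<bar> = q * \<bar>V - p * W\<bar>"
        using q by (simp add: slope_def W_def V_def abs_mult qr2)
      also have "\<dots> \<le> q * C" using VW C q by (intro mult_left_mono) auto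
      finally show ?thesis by (simp add: mult_ac)
    qed
    have 3: "\<bar>r * slope' w v \<tau> r\<bar> \<le> C * q"
    proof -
      define X where "X = (2 * p - (N - 2)) * V + force W - p * V - (p + 2) * (V - p * W)"
      have "r * slope' w v \<tau> r = q * X"
        unfolding X_def W_def V_def slope'_def qr2(3)[symmetric] by (simp only: mult.assoc)
      moreover have "\<bar>X\<bar> \<le> C"
      proof -
        have "\<bar>(2 * p - (N - 2)) * V\<bar> \<le> (2 * p - (N - 2)) * B" "\<bar>p * V\<bar> \<le> p * B"
          "\<bar>(p + 2) * (V - p * W)\<bar> \<le> (p + 2) * ((1 + p) * B)"
          unfolding abs_mult using V VW c exponents by (auto intro!: mult_mono)
        then show ?thesis using F C(3) unfolding X_def by linarith
      qed
      ultimately show ?thesis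
        using q mult_left_mono[of "\<bar>X\<bar>" C q] by (simp add: abs_mult mult_ac)
    qed
    from 1 2 3 show ?thesis by (simp add: q_def)
  qed
  then show ?thesis by blast
qed

lemma slope'_continuous: "continuous_on {0<..} (slope' w v \<tau>)"
  unfolding slope'_def[abs_def]
  by (intro continuous_intros continuous_on_compose2[OF zero_energy_orbit_continuous(1)[OF orbit, of UNIV]]
      continuous_on_compose2[OF zero_energy_orbit_continuous(2)[OF orbit, of UNIV]]) auto

lemma profile_measurable: "(\<lambda>x::'a::euclidean_space. profile w \<tau> (norm x)) \<in> borel_measurable borel"
proof -
  have [measurable]: "w \<in> borel_measurable borel"
    by (intro borel_measurable_continuous_onI zero_energy_orbit_continuous[OF orbit])
  show ?thesis unfolding profile_def by measurable
qed

text \<open>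
  The envelope grows like \<open>r\<^sup>c\<close>, and \<open>c - p = - (N - 2 - p)\<close>.
\<close>
lemma profile_decay:
  assumes "r > 1"
  shows "\<bar>profile w \<tau> r\<bar> \<le> sqrt (2 * coercivity) * (1 + exp (- (2 * p - (N - 2)) * \<tau>)) * r powr - (N - 2 - p)"
proof -
  define c where "c = 2 * p - (N - 2)"
  have c: "c > 0" using exponents by (simp add: c_def)
  have e: "exp (c * (ln r - \<tau>)) = r powr c * exp (- c * \<tau>)"
    using assms by (simp add: powr_def algebra_simps flip: exp_add)
  have "1 \<le> r powr c" using assms c by (simp add: ge_one_powr_ge_zero)
  then have "1 + exp (c * (ln r - \<tau>)) \<le> r powr c * (1 + exp (- c * \<tau>))"
    unfolding e by (simp add: algebra_simps)
  then have "sqrt (2 * coercivity) * (1 + exp (c * (ln r - \<tau>)))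
      \<le> sqrt (2 * coercivity) * (r powr c * (1 + exp (- c * \<tau>)))"
    using coercivity_pos by (intro mult_left_mono) auto
  then have "\<bar>w (ln r - \<tau>)\<bar> \<le> sqrt (2 * coercivity) * (r powr c * (1 + exp (- c * \<tau>)))"
    using zero_energy_orbit_bound(1)[OF orbit, of "ln r - \<tau>", unfolded envelope_def, folded c_def]
    by linarith
  then have "r powr - p * \<bar>w (ln r - \<tau>)\<bar> \<le> r powr - p * (sqrt (2 * coercivity) * (r powr c * (1 + exp (- c * \<tau>))))"
    by (intro mult_left_mono) auto
  also have "\<dots> = sqrt (2 * coercivity) * (1 + exp (- c * \<tau>)) * (r powr - p * r powr c)"
    by (simp add: mult_ac)
  also have "r powr - p * r powr c = r powr - (N - 2 - p)"
    unfolding powr_add[symmetric] by (simp add: c_def algebra_simps)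
  finally show ?thesis by (simp add: profile_def abs_mult c_def)
qed

lemma profile_changes_sign:
  assumes "R > 0"
  shows "(\<exists>r>R. profile w \<tau> r > 0) \<and> (\<exists>r>R. profile w \<tau> r < 0)"
proof -
  obtain s t where st: "s > ln R - \<tau>" "w s > 0" "t > ln R - \<tau>" "w t < 0"
    using zero_energy_orbit_oscillates[OF orbit, of "ln R - \<tau>"] by blast
  have "R < exp (x + \<tau>)" if "x > ln R - \<tau>" for x
    using that assms by (metis diff_less_eq exp_less_cancel_iff exp_ln)
  then show ?thesis
    using st by (intro conjI exI[of _ "exp (s + \<tau>)"] exI[of _ "exp (t + \<tau>)"])
      (auto simp: profile_def mult_pos_neg)
qed

text \<open>
  Since \<open>|w|\<close> is bounded below near \<open>- \<infinity>\<close>, the modulus of the profile is near the origin at least a positive multiple of \<open>r\<^sup>-\<^sup>p\<close>.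
\<close>
lemma profile_singular:
  "filterlim (\<lambda>x::'a::euclidean_space. profile w \<tau> (norm x)) at_infinity (at 0)"
proof -
  have sol: "\<And>s. solves_at w v s" and e0: "energy w v 0 = 0" "v 0 \<noteq> 0"
    using orbit by (auto simp: zero_energy_orbit_def)
  obtain \<delta> where \<delta>: "\<delta> > 0" "\<And>s. s \<le> - 1 \<Longrightarrow> \<bar>w s\<bar> \<ge> \<delta>"
    using away_from_zero_below[OF sol e0] by blast
  have nz: "filterlim (\<lambda>x::'a. norm x) (at_right 0) (at 0)"
    unfolding filterlim_at by (auto simp: eventually_at_filter intro!: tendsto_eq_intros)
  have "filterlim (\<lambda>r::real. r powr p) (at_right 0) (at_right 0)"
    unfolding filterlim_at using exponents
    by (auto simp: eventually_at_filter intro!: tendsto_eq_intros)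
  from filterlim_compose[OF filterlim_inverse_at_top_right this]
  have "filterlim (\<lambda>r::real. r powr - p) at_top (at_right 0)" by (simp add: powr_minus)
  from filterlim_tendsto_pos_mult_at_top[OF tendsto_const \<delta>(1) filterlim_compose[OF this nz]]
  have lim: "filterlim (\<lambda>x::'a. \<delta> * norm x powr - p) at_top (at 0)" .
  have "\<forall>\<^sub>F x::'a in at 0. norm x < exp (\<tau> - 1)"
    by (rule order_tendstoD(2)[OF tendsto_norm_zero[OF tendsto_ident_at]]) simp
  moreover have "\<forall>\<^sub>F x::'a in at 0. x \<noteq> 0" by (simp add: eventually_at_filter)
  ultimately have "\<forall>\<^sub>F x::'a in at 0. \<delta> * norm x powr - p \<le> norm (profile w \<tau> (norm x))"
  proof eventually_elim
    case (elim x)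
    then have "ln (norm x) < ln (exp (\<tau> - 1))" by (subst ln_less_cancel_iff) auto
    then have "\<delta> \<le> \<bar>w (ln (norm x) - \<tau>)\<bar>" by (intro \<delta>(2)) simp
    then have "norm x powr - p * \<delta> \<le> norm x powr - p * \<bar>w (ln (norm x) - \<tau>)\<bar>"
      by (intro mult_left_mono) auto
    then show ?case by (simp add: profile_def abs_mult mult.commute)
  qed
  then show ?thesis
    by (intro filterlim_norm_at_top_imp_at_infinity filterlim_at_top_mono[OF lim])
qed

text \<open>
  All three claims rest on \<open>p + 2 < N\<close>. For the integrability of \<open>|U|\<^sup>\<alpha>\<^sup>+\<^sup>1\<close> note that \<open>p (\<alpha> + 1) = p + 2\<close>.
\<close>
theorem profile_stationary_solution:
  assumes dim: "real DIM('a::euclidean_space) = N"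
  shows "stationary_solution \<alpha> (\<lambda>x::'a. profile w \<tau> (norm x))"
    and "Ck_on 2 (\<lambda>x::'a. profile w \<tau> (norm x)) (- {0})"
    and "Lp_loc (\<alpha> + 1) (\<lambda>x::'a. profile w \<tau> (norm x))"
proof -
  have zero: "profile w \<tau> 0 = 0" "slope w v \<tau> 0 = 0" by (simp_all add: profile_def slope_def)
  have \<gamma>: "0 \<le> p + 2" "p + 2 < real DIM('a)" using exponents dim by auto
  have [measurable]: "(\<lambda>x::'a. profile w \<tau> (norm x)) \<in> borel_measurable borel"
    by (rule profile_measurable)
  show "stationary_solution \<alpha> (\<lambda>x::'a. profile w \<tau> (norm x))"
    unfolding stationary_solution_def
  proof (rule radial_distributional_solution[OF \<gamma>, where u = "profile w \<tau>" and k = "slope w v \<tau>" and k' = "slope' w v \<tau>"])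
    show "\<bar>profile w \<tau> (norm x)\<bar> powr \<alpha> * profile w \<tau> (norm x)
       = - (norm x * slope' w v \<tau> (norm x) + real DIM('a) * slope w v \<tau> (norm x))" for x :: 'a
      using profile_equation[of "norm x"] zero unfolding dim by (cases "x = 0") auto
  qed (use profile_derivative slope_derivative zero profile_bounds in \<open>simp_all\<close>)
  show "Ck_on 2 (\<lambda>x::'a. profile w \<tau> (norm x)) (- {0})"
    using profile_derivative slope_derivative slope'_continuous by (rule radial_Ck_on_2[OF refl])
  show "Lp_loc (\<alpha> + 1) (\<lambda>x::'a. profile w \<tau> (norm x))"
  proof (rule Lp_loc_of_norm_powr_bound[OF \<gamma> profile_measurable])
    fix R
    obtain C where C: "\<And>r. 0 < r \<Longrightarrow> r \<le> R \<Longrightarrow> \<bar>profile w \<tau> r\<bar> \<le> C * r powr - (p + 2) * r\<^sup>2"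
      using profile_bounds by blast
    have "\<bar>profile w \<tau> (norm x)\<bar> powr (\<alpha> + 1) \<le> \<bar>C\<bar> powr (\<alpha> + 1) * norm x powr - (p + 2)"
      if x: "norm x \<le> R" for x :: 'a
    proof (cases "x = 0")
      case False
      have "norm x powr - (p + 2) * (norm x)\<^sup>2 = norm x powr - p"
        using False by (simp add: powr_diff field_simps)
      then have "\<bar>profile w \<tau> (norm x)\<bar> \<le> C * norm x powr - p"
        using C[of "norm x"] x False by (simp add: mult.assoc)
      also have "\<dots> \<le> \<bar>C\<bar> * norm x powr - p" by (intro mult_right_mono) auto
      finally have "\<bar>profile w \<tau> (norm x)\<bar> powr (\<alpha> + 1) \<le> (\<bar>C\<bar> * norm x powr - p) powr (\<alpha> + 1)"
        using exponents by (intro powr_mono2) auto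
      also have "\<dots> = \<bar>C\<bar> powr (\<alpha> + 1) * norm x powr - (p + 2)"
        using exponents(5) by (simp add: powr_mult powr_powr algebra_simps)
      finally show ?thesis .
    qed (use exponents zero in simp)
    then show "\<exists>C. \<forall>x::'a. norm x \<le> R \<longrightarrow> \<bar>profile w \<tau> (norm x)\<bar> powr (\<alpha> + 1) \<le> C * norm x powr - (p + 2)"
      by blast
  qed
qed

end

end

section \<open>The two-parameter family\<close>

(* U p is a total function whose value at the origin carries no information. All requirements,
   including that different parameters give different solutions, therefore concern x \<noteq> 0 only.
   u p is the radial profile of U p. *)
theorem corollary6p2:
  fixes \<alpha> :: real
  assumes "CARD('n::finite) \<ge> 3"
    and "2 / (real CARD('n) - 2) < \<alpha>" and "\<alpha> < 4 / (real CARD('n) - 2)"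
  shows "\<exists>(P :: (real \<times> real) set) (U :: real \<times> real \<Rightarrow> real ^ 'n \<Rightarrow> real)
            (u :: real \<times> real \<Rightarrow> real \<Rightarrow> real).
     open P \<and> P \<noteq> {} \<and>
     (\<forall>p\<in>P. \<forall>q\<in>P. p \<noteq> q \<longrightarrow> (\<exists>x. x \<noteq> 0 \<and> U p x \<noteq> U q x)) \<and>
     (\<forall>p\<in>P.
        (\<forall>x. x \<noteq> 0 \<longrightarrow> U p x = u p (norm x)) \<and>
        changes_sign_on (U p) (- {0}) \<and>
        Ck_on 2 (U p) (- {0}) \<and>
        Lp_loc (\<alpha> + 1) (U p) \<and>
        stationary_solution \<alpha> (U p) \<and>
        \<not> (\<exists>l. (U p \<longlongrightarrow> l) (at 0)) \<and>
        (\<exists>C. \<forall>x. norm x > 1 \<longrightarrow>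
           \<bar>U p x\<bar> \<le> C * norm x powr (- (real CARD('n) - 2 - 2 / \<alpha>))) \<and>
        (\<forall>R>0. changes_sign_on (u p) {R<..}))"
proof -
  define N where "N = real CARD('n)"
  define e where "e = 2 / \<alpha>"
  interpret radial_emden_fowler N \<alpha> e
    using assms by unfold_locales (auto simp: N_def e_def)
  \<comment> \<open>The bottom of the right-hand well; every \<open>a\<close> between \<open>0\<close> and it has negative potential energy.\<close>
  define a\<^sub>0 where "a\<^sub>0 = (e * (N - 2 - e)) powr (1 / \<alpha>)"
  \<comment> \<open>One orbit is chosen for each \<open>a\<close>; the second parameter is a translation in \<open>ln r\<close>, that is, a scaling of \<open>u\<close>.\<close>
  obtain w v where orbit: "\<And>a. 0 < a \<Longrightarrow> a < a\<^sub>0 \<Longrightarrow> zero_energy_orbit a (w a) (v a)"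
    using zero_energy_orbit_exists unfolding a\<^sub>0_def by metis
  define P where "P = {0<..<a\<^sub>0} \<times> (UNIV :: real set)"
  define u where "u p = profile (w (fst p)) (snd p)" for p :: "real \<times> real"
  define U :: "real \<times> real \<Rightarrow> real ^ 'n \<Rightarrow> real" where "U p x = u p (norm x)" for p x
  have orbit_P: "zero_energy_orbit (fst p) (w (fst p)) (v (fst p))" if "p \<in> P" for p
    using that by (auto simp: P_def intro: orbit)
  have U_fun: "U p = (\<lambda>x. profile (w (fst p)) (snd p) (norm x))" for p
    by (auto simp: U_def u_def)
  have dim: "real DIM(real ^ 'n) = N" by (simp add: N_def)
  have point: "\<exists>x :: real ^ 'n. norm x = r" if "r > 0" for r
    using vector_choose_size[of r] that by auto
  have open_P: "open P" unfolding P_def by (intro open_Times) auto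
  have "e * (N - 2 - e) > 0" using exponents by simp
  then have "a\<^sub>0 > 0" unfolding a\<^sub>0_def powr_gt_zero by (rule less_imp_neq[symmetric])
  then have "(a\<^sub>0 / 2, 0) \<in> P" by (simp add: P_def)
  then have P_nonempty: "P \<noteq> {}" by blast
  have distinct: "\<exists>x. x \<noteq> 0 \<and> U p x \<noteq> U q x" if p: "p \<in> P" and q: "q \<in> P" and "p \<noteq> q" for p q
  proof (rule ccontr)
    assume "\<not> (\<exists>x. x \<noteq> 0 \<and> U p x \<noteq> U q x)"
    then have eq: "U p x = U q x" if "x \<noteq> 0" for x using that by blast
    have "w (fst p) (s - snd p) = w (fst q) (s - snd q)" for s
    proof -
      obtain x :: "real ^ 'n" where x: "norm x = exp s" using point[of "exp s"] by auto
      then have "x \<noteq> 0" using exp_gt_zero[of s] by force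
      from eq[OF this] show ?thesis by (simp add: U_fun x profile_def)
    qed
    from zero_energy_orbit_translates[OF orbit_P[OF p] orbit_P[OF q] this]
    show False using \<open>p \<noteq> q\<close> by (simp add: prod_eq_iff)
  qed
  have properties: "(\<forall>x. x \<noteq> 0 \<longrightarrow> U p x = u p (norm x)) \<and>
        changes_sign_on (U p) (- {0}) \<and>
        Ck_on 2 (U p) (- {0}) \<and>
        Lp_loc (\<alpha> + 1) (U p) \<and>
        stationary_solution \<alpha> (U p) \<and>
        \<not> (\<exists>l. (U p \<longlongrightarrow> l) (at 0)) \<and>
        (\<exists>C. \<forall>x. norm x > 1 \<longrightarrow>
           \<bar>U p x\<bar> \<le> C * norm x powr (- (real CARD('n) - 2 - 2 / \<alpha>))) \<and>
        (\<forall>R>0. changes_sign_on (u p) {R<..})" if p: "p \<in> P" for p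
  proof (intro conjI)
    note o = orbit_P[OF p]
    show "\<forall>x. x \<noteq> 0 \<longrightarrow> U p x = u p (norm x)" by (simp add: U_def)
    show sign: "\<forall>R>0. changes_sign_on (u p) {R<..}"
      using profile_changes_sign[OF o] by (auto simp: changes_sign_on_def u_def)
    show "changes_sign_on (U p) (- {0})"
    proof -
      obtain r s where "r > 1" "u p r > 0" "s > 1" "u p s < 0"
        using sign[rule_format, of 1] by (auto simp: changes_sign_on_def)
      moreover obtain x y :: "real ^ 'n" where "norm x = r" "norm y = s"
        using point[of r] point[of s] calculation by auto
      ultimately show ?thesis
        unfolding changes_sign_on_def by (intro conjI bexI[of _ x] bexI[of _ y]) (auto simp: U_def)
    qed
    show "Ck_on 2 (U p) (- {0})" "Lp_loc (\<alpha> + 1) (U p)" "stationary_solution \<alpha> (U p)"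
      unfolding U_fun by (rule profile_stationary_solution[OF o dim])+
    show "\<not> (\<exists>l. (U p \<longlongrightarrow> l) (at 0))"
      unfolding U_fun
      using not_tendsto_and_filterlim_at_infinity[OF _ _ profile_singular[OF o]] by auto
    show "\<exists>C. \<forall>x. norm x > 1 \<longrightarrow>
           \<bar>U p x\<bar> \<le> C * norm x powr (- (real CARD('n) - 2 - 2 / \<alpha>))"
      unfolding U_fun N_def[symmetric] e_def[symmetric] using profile_decay[OF o] by blast
  qed
  have "\<forall>p\<in>P. \<forall>q\<in>P. p \<noteq> q \<longrightarrow> (\<exists>x. x \<noteq> 0 \<and> U p x \<noteq> U q x)"
    using distinct by blast
  from conjI[OF open_P conjI[OF P_nonempty conjI[OF this ballI[OF properties]]]]
  show ?thesis by (intro exI)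
qed

end
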